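(* Let $q$ be a non-zero complex number with $|q|\neq 1$ such that $\theta=\frac{1}{\pi}\arg(q)$ is irrational. Then the conditional expectation $E_\psi:C(U_q(2))\to C(U_q(2)/_\psi\mathbb{T})$ has infinite Watatani index, i.e. $E_\psi$ is not of index-finite type.
   Context: For a non-zero complex number $q$, $C(U_q(2))$ denotes the universal unital $C^*$-algebra generated by elements $a,b,D$ satisfying $$ba=q\,ab,\quad a^*b=q\,ba^*,\quad bb^*=b^*b,\quad aa^*+bb^*=1,$$ $$aD=Da,\quad bD=q^2|q|^{-2}Db,\quad DD^*=D^*D=1,\quad a^*a+|q|^2b^*b=1,$$ with comultiplication the unital $*$-homomorphism $\Delta:C(U_q(2))\to C(U_q(2))\otimes C(U_q(2))$ given by $$\Delta(a)=a\otimes a-\bar q\,b\otimes Db^*,\quad \Delta(b)=a\otimes b+b\otimes Da^*,\quad \Delta(D)=D\otimes D.$$ Let $\mathbf{t}:z\mapsto z$ be the standard unitary generator of $C(\mathbb{T})$ and let $h_{\mathbb{T}}$ be the Haar state on $C(\mathbb{T})$ (integration against normalized Lebesgue measure on the circle). Let $\psi:C(U_q(2))\to C(\mathbb{T})$ be the unital $*$-homomorphism with $\psi(a)=\mathbf{t}$, $\psi(b)=0$, $\psi(D)=1$. Define $$C(U_q(2)/_\psi\mathbb{T})=\{x\in C(U_q(2)):(\psi\otimes\mathrm{id})\Delta(x)=1\otimes x\},\qquad E_\psi=((h_{\mathbb{T}}\circ\psi)\otimes\mathrm{id})\circ\Delta,$$ which is a conditional expectation from $C(U_q(2))$ onto $C(U_q(2)/_\psi\mathbb{T})$.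 For a unital inclusion of $C^*$-algebras $\mathcal{B}\subset\mathcal{A}$, a conditional expectation $E:\mathcal{A}\to\mathcal{B}$ is of index-finite type if there is a finite set $\{(u_j,v_j):1\le j\le n\}\subseteq\mathcal{A}\times\mathcal{A}$ (a quasi-basis) such that $x=\sum_j u_jE(v_jx)=\sum_j E(xu_j)v_j$ for all $x\in\mathcal{A}$; in that case its Watatani index is $\sum_j u_jv_j$. $E$ has infinite Watatani index if it is not of index-finite type. *)

theory Defs
  imports "HOL-Analysis.Analysis" "HOL-Algebra.Module"
begin

section \<open>Unital C*-algebras\<close>

definition complex_field :: "complex ring" where
  "complex_field = \<lparr>carrier = UNIV, mult = (*), one = 1, zero = 0, add = (+)\<rparr>"

record 'a cstar = "(complex, 'a) module" +
  star :: "'a \<Rightarrow> 'a"  (\<open>(_\<^sup>\<star>\<index>)\<close> [1000] 1000)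
  cnorm :: "'a \<Rightarrow> real"  (\<open>(\<parallel>_\<parallel>\<index>)\<close>)

definition cstar_norm_on :: "'a cstar \<Rightarrow> 'a set \<Rightarrow> ('a \<Rightarrow> real) \<Rightarrow> bool" where
  "cstar_norm_on A S N \<longleftrightarrow>
     (\<forall>x\<in>S. 0 \<le> N x) \<and>
     (\<forall>x\<in>S. N x = 0 \<longleftrightarrow> x = \<zero>\<^bsub>A\<^esub>) \<and>
     (\<forall>x\<in>S. \<forall>y\<in>S. N (x \<oplus>\<^bsub>A\<^esub> y) \<le> N x + N y) \<and>
     (\<forall>c. \<forall>x\<in>S. N (c \<odot>\<^bsub>A\<^esub> x) = cmod c * N x) \<and>
     (\<forall>x\<in>S. \<forall>y\<in>S. N (x \<otimes>\<^bsub>A\<^esub> y) \<le> N x * N y) \<and>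
     (\<forall>x\<in>S. N (x\<^sup>\<star>\<^bsub>A\<^esub> \<otimes>\<^bsub>A\<^esub> x) = (N x)\<^sup>2)"

locale unital_cstar_algebra = A?: ring A + module complex_field A
  for A :: "'a cstar" (structure) +
  assumes smult_mult_left:
      "\<lbrakk>x \<in> carrier A; y \<in> carrier A\<rbrakk> \<Longrightarrow> (c \<odot> x) \<otimes> y = c \<odot> (x \<otimes> y)"
    and smult_mult_right:
      "\<lbrakk>x \<in> carrier A; y \<in> carrier A\<rbrakk> \<Longrightarrow> x \<otimes> (c \<odot> y) = c \<odot> (x \<otimes> y)"
    and star_closed: "x \<in> carrier A \<Longrightarrow> x\<^sup>\<star> \<in> carrier A"
    and star_star: "x \<in> carrier A \<Longrightarrow> (x\<^sup>\<star>)\<^sup>\<star> = x"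
    and star_add: "\<lbrakk>x \<in> carrier A; y \<in> carrier A\<rbrakk> \<Longrightarrow> (x \<oplus> y)\<^sup>\<star> = x\<^sup>\<star> \<oplus> y\<^sup>\<star>"
    and star_smult: "x \<in> carrier A \<Longrightarrow> (c \<odot> x)\<^sup>\<star> = cnj c \<odot> x\<^sup>\<star>"
    and star_mult: "\<lbrakk>x \<in> carrier A; y \<in> carrier A\<rbrakk> \<Longrightarrow> (x \<otimes> y)\<^sup>\<star> = y\<^sup>\<star> \<otimes> x\<^sup>\<star>"
    and cstar_norm: "cstar_norm_on A (carrier A) (cnorm A)"
    and one_not_zero: "\<one> \<noteq> \<zero>"
    and complete:
      "\<lbrakk>\<And>n. X n \<in> carrier A;
        \<And>e. 0 < e \<Longrightarrow> \<exists>M. \<forall>m\<ge>M. \<forall>n\<ge>M. \<parallel>X m \<ominus> X n\<parallel> < e\<rbrakk>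
       \<Longrightarrow> \<exists>x\<in>carrier A. (\<lambda>n. \<parallel>X n \<ominus> x\<parallel>) \<longlonglongrightarrow> 0"

definition cstar_closure :: "'a cstar \<Rightarrow> 'a set \<Rightarrow> 'a set" where
  "cstar_closure A S = {x \<in> carrier A. \<forall>e>0. \<exists>y\<in>S. \<parallel>x \<ominus>\<^bsub>A\<^esub> y\<parallel>\<^bsub>A\<^esub> < e}"

definition unital_star_subalgebra :: "'a cstar \<Rightarrow> 'a set \<Rightarrow> bool" where
  "unital_star_subalgebra A S \<longleftrightarrow>
     S \<subseteq> carrier A \<and> \<one>\<^bsub>A\<^esub> \<in> S \<and>
     (\<forall>x\<in>S. \<forall>y\<in>S. x \<oplus>\<^bsub>A\<^esub> y \<in> S \<and> x \<otimes>\<^bsub>A\<^esub> y \<in> S) \<and>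
     (\<forall>c. \<forall>x\<in>S. c \<odot>\<^bsub>A\<^esub> x \<in> S) \<and> (\<forall>x\<in>S. x\<^sup>\<star>\<^bsub>A\<^esub> \<in> S)"

definition unital_cstar_subalgebra :: "'a cstar \<Rightarrow> 'a set \<Rightarrow> bool" where
  "unital_cstar_subalgebra A S \<longleftrightarrow> unital_star_subalgebra A S \<and> cstar_closure A S = S"

definition cstar_generated :: "'a cstar \<Rightarrow> 'a set \<Rightarrow> 'a set" where
  "cstar_generated A G = \<Inter>{S. unital_cstar_subalgebra A S \<and> G \<subseteq> S}"

definition star_hom :: "'a cstar \<Rightarrow> 'b cstar \<Rightarrow> ('a \<Rightarrow> 'b) \<Rightarrow> bool" where
  "star_hom A B \<phi> \<longleftrightarrow>
     \<phi> \<in> ring_hom A B \<and>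
     (\<forall>c. \<forall>x\<in>carrier A. \<phi> (c \<odot>\<^bsub>A\<^esub> x) = c \<odot>\<^bsub>B\<^esub> \<phi> x) \<and>
     (\<forall>x\<in>carrier A. \<phi> (x\<^sup>\<star>\<^bsub>A\<^esub>) = (\<phi> x)\<^sup>\<star>\<^bsub>B\<^esub>)"

definition bounded_linear_map :: "'a cstar \<Rightarrow> 'b cstar \<Rightarrow> ('a \<Rightarrow> 'b) \<Rightarrow> bool" where
  "bounded_linear_map A B F \<longleftrightarrow>
     F \<in> carrier A \<rightarrow> carrier B \<and>
     (\<forall>x\<in>carrier A. \<forall>y\<in>carrier A. F (x \<oplus>\<^bsub>A\<^esub> y) = F x \<oplus>\<^bsub>B\<^esub> F y) \<and>
     (\<forall>c. \<forall>x\<in>carrier A. F (c \<odot>\<^bsub>A\<^esub> x) = c \<odot>\<^bsub>B\<^esub> F x) \<and>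
     (\<exists>K. \<forall>x\<in>carrier A. \<parallel>F x\<parallel>\<^bsub>B\<^esub> \<le> K * \<parallel>x\<parallel>\<^bsub>A\<^esub>)"

section \<open>Minimal tensor products\<close>

definition lin_indep :: "'a cstar \<Rightarrow> nat \<Rightarrow> (nat \<Rightarrow> 'a) \<Rightarrow> bool" where
  "lin_indep A n x \<longleftrightarrow>
     (\<forall>c. (\<Oplus>\<^bsub>A\<^esub>i\<in>{..<n}. c i \<odot>\<^bsub>A\<^esub> x i) = \<zero>\<^bsub>A\<^esub> \<longrightarrow> (\<forall>i<n. c i = 0))"

definition elementary_sums ::
    "'a cstar \<Rightarrow> 'b cstar \<Rightarrow> 't cstar \<Rightarrow> ('a \<Rightarrow> 'b \<Rightarrow> 't) \<Rightarrow> 't set" where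
  "elementary_sums A B T tens =
     {(\<Oplus>\<^bsub>T\<^esub>i\<in>{..<n}. tens (x i) (y i)) | (n::nat) x y.
        x \<in> {..<n} \<rightarrow> carrier A \<and> y \<in> {..<n} \<rightarrow> carrier B}"

text \<open>
  \<open>T\<close>, with \<open>tens x y\<close> in the role of the elementary tensor of \<open>x\<close> and \<open>y\<close>, is the
  minimal C*-tensor product of \<open>A\<close> and \<open>B\<close>.  By \<open>tens_inj\<close> the set of elementary sums is a
  copy of the algebraic tensor product; the norm of \<open>T\<close> restricts to the least of all
  C*-norms on it, and \<open>T\<close> is its completion.
\<close>

locale min_tensor_product =
  A: unital_cstar_algebra A + B: unital_cstar_algebra B + T: unital_cstar_algebra T
  for A :: "'a cstar" and B :: "'b cstar" and T :: "'t cstar" +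
  fixes tens :: "'a \<Rightarrow> 'b \<Rightarrow> 't"
  assumes tens_closed:
      "\<lbrakk>x \<in> carrier A; y \<in> carrier B\<rbrakk> \<Longrightarrow> tens x y \<in> carrier T"
    and tens_add_left:
      "\<lbrakk>x \<in> carrier A; x' \<in> carrier A; y \<in> carrier B\<rbrakk>
       \<Longrightarrow> tens (x \<oplus>\<^bsub>A\<^esub> x') y = tens x y \<oplus>\<^bsub>T\<^esub> tens x' y"
    and tens_add_right:
      "\<lbrakk>x \<in> carrier A; y \<in> carrier B; y' \<in> carrier B\<rbrakk>
       \<Longrightarrow> tens x (y \<oplus>\<^bsub>B\<^esub> y') = tens x y \<oplus>\<^bsub>T\<^esub> tens x y'"
    and tens_smult_left:
      "\<lbrakk>x \<in> carrier A; y \<in> carrier B\<rbrakk> \<Longrightarrow> tens (c \<odot>\<^bsub>A\<^esub> x) y = c \<odot>\<^bsub>T\<^esub> tens x y"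
    and tens_smult_right:
      "\<lbrakk>x \<in> carrier A; y \<in> carrier B\<rbrakk> \<Longrightarrow> tens x (c \<odot>\<^bsub>B\<^esub> y) = c \<odot>\<^bsub>T\<^esub> tens x y"
    and tens_mult:
      "\<lbrakk>x \<in> carrier A; x' \<in> carrier A; y \<in> carrier B; y' \<in> carrier B\<rbrakk>
       \<Longrightarrow> tens x y \<otimes>\<^bsub>T\<^esub> tens x' y' = tens (x \<otimes>\<^bsub>A\<^esub> x') (y \<otimes>\<^bsub>B\<^esub> y')"
    and tens_star:
      "\<lbrakk>x \<in> carrier A; y \<in> carrier B\<rbrakk> \<Longrightarrow> (tens x y)\<^sup>\<star>\<^bsub>T\<^esub> = tens (x\<^sup>\<star>\<^bsub>A\<^esub>) (y\<^sup>\<star>\<^bsub>B\<^esub>)"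
    and tens_one: "tens \<one>\<^bsub>A\<^esub> \<one>\<^bsub>B\<^esub> = \<one>\<^bsub>T\<^esub>"
    and tens_inj:
      "\<lbrakk>xs \<in> {..<n} \<rightarrow> carrier A; ys \<in> {..<n} \<rightarrow> carrier B; lin_indep A n xs;
        (\<Oplus>\<^bsub>T\<^esub>i\<in>{..<n}. tens (xs i) (ys i)) = \<zero>\<^bsub>T\<^esub>; i < n\<rbrakk> \<Longrightarrow> ys i = \<zero>\<^bsub>B\<^esub>"
    and tens_dense: "cstar_closure T (elementary_sums A B T tens) = carrier T"
    and norm_minimal:
      "\<lbrakk>cstar_norm_on T (elementary_sums A B T tens) N; t \<in> elementary_sums A B T tens\<rbrakk>
       \<Longrightarrow> \<parallel>t\<parallel>\<^bsub>T\<^esub> \<le> N t"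

text \<open>
  \<open>F\<close> is the tensor product of the maps \<open>f\<close> and \<open>g\<close>, both defined on \<open>A\<close>: the continuous linear
  extension to \<open>T\<close> of \<open>tens x y \<mapsto> tens' (f x) (g y)\<close>, unique since elementary sums are dense.
  Taking scalar multiplication for \<open>tens'\<close> gives slice maps.
\<close>

definition is_tensor_map ::
    "'a cstar \<Rightarrow> 't cstar \<Rightarrow> ('a \<Rightarrow> 'a \<Rightarrow> 't) \<Rightarrow> 'y cstar \<Rightarrow> ('c \<Rightarrow> 'd \<Rightarrow> 'y) \<Rightarrow>
     ('a \<Rightarrow> 'c) \<Rightarrow> ('a \<Rightarrow> 'd) \<Rightarrow> ('t \<Rightarrow> 'y) \<Rightarrow> bool" where
  "is_tensor_map A T tens Y tens' f g F \<longleftrightarrow>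
     bounded_linear_map T Y F \<and>
     (\<forall>x\<in>carrier A. \<forall>y\<in>carrier A. F (tens x y) = tens' (f x) (g y))"

section \<open>Continuous functions on the circle\<close>

text \<open>Functions on the circle are represented by their extension by zero to the plane.\<close>

definition circle_fun :: "(complex \<Rightarrow> complex) \<Rightarrow> complex \<Rightarrow> complex" where
  "circle_fun f = (\<lambda>z. if z \<in> sphere 0 1 then f z else 0)"

definition circle_algebra :: "(complex \<Rightarrow> complex) cstar" where
  "circle_algebra =
     \<lparr>carrier = {f. continuous_on (sphere 0 1) f \<and> circle_fun f = f},
      mult = (\<lambda>f g z. f z * g z), one = circle_fun (\<lambda>_. 1),
      zero = (\<lambda>_. 0), add = (\<lambda>f g z. f z + g z),
      smult = (\<lambda>c f z. c * f z),
      star = (\<lambda>f z. cnj (f z)),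
      cnorm = (\<lambda>f. SUP z\<in>sphere 0 1. cmod (f z))\<rparr>"

definition circle_gen :: "complex \<Rightarrow> complex" where
  "circle_gen = circle_fun (\<lambda>z. z)"

definition circle_haar :: "(complex \<Rightarrow> complex) \<Rightarrow> complex" where
  "circle_haar f = integral {0..1} (\<lambda>s. f (cis (2 * pi * s)))"

section \<open>The quantum group \<open>U\<^sub>q(2)\<close>\<close>

locale Uq2_relations = unital_cstar_algebra A for A :: "'a cstar" (structure) +
  fixes q :: complex and a b D :: 'a
  assumes gens_closed: "a \<in> carrier A" "b \<in> carrier A" "D \<in> carrier A"
    and rel_ba: "b \<otimes> a = q \<odot> (a \<otimes> b)"
    and rel_astar_b: "a\<^sup>\<star> \<otimes> b = q \<odot> (b \<otimes> a\<^sup>\<star>)"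
    and rel_b_normal: "b \<otimes> b\<^sup>\<star> = b\<^sup>\<star> \<otimes> b"
    and rel_aastar: "a \<otimes> a\<^sup>\<star> \<oplus> b \<otimes> b\<^sup>\<star> = \<one>"
    and rel_aD: "a \<otimes> D = D \<otimes> a"
    and rel_bD: "b \<otimes> D = (q\<^sup>2 / complex_of_real ((cmod q)\<^sup>2)) \<odot> (D \<otimes> b)"
    and rel_D_unitary: "D \<otimes> D\<^sup>\<star> = \<one>" "D\<^sup>\<star> \<otimes> D = \<one>"
    and rel_astara: "a\<^sup>\<star> \<otimes> a \<oplus> complex_of_real ((cmod q)\<^sup>2) \<odot> (b\<^sup>\<star> \<otimes> b) = \<one>"

text \<open>
  In the universal property the test algebras \<open>B\<close> have their carriers in the type \<open>'a\<close> of the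
  elements of \<open>A\<close>.  This is no restriction: \<open>A\<close> is nonzero, so \<open>'a\<close> has at least the
  cardinality of the continuum, whereas a C*-algebra generated by three elements has at most
  that cardinality and hence has an isomorphic copy carried by a subset of \<open>'a\<close>.
\<close>

definition is_C_Uq2 :: "complex \<Rightarrow> 'a cstar \<Rightarrow> 'a \<Rightarrow> 'a \<Rightarrow> 'a \<Rightarrow> bool" where
  "is_C_Uq2 q A a b D \<longleftrightarrow>
     Uq2_relations A q a b D \<and>
     cstar_generated A {a, b, D} = carrier A \<and>
     (\<forall>(B :: 'a cstar) a' b' D'. Uq2_relations B q a' b' D' \<longrightarrow>
        (\<exists>\<phi>. star_hom A B \<phi> \<and> \<phi> a = a' \<and> \<phi> b = b' \<and> \<phi> D = D'))"

definition is_Uq2_comult ::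
    "complex \<Rightarrow> 'a cstar \<Rightarrow> 'a \<Rightarrow> 'a \<Rightarrow> 'a \<Rightarrow> 't cstar \<Rightarrow> ('a \<Rightarrow> 'a \<Rightarrow> 't) \<Rightarrow> ('a \<Rightarrow> 't) \<Rightarrow> bool" where
  "is_Uq2_comult q A a b D T tens \<Delta> \<longleftrightarrow>
     star_hom A T \<Delta> \<and>
     \<Delta> a = tens a a \<ominus>\<^bsub>T\<^esub> cnj q \<odot>\<^bsub>T\<^esub> tens b (D \<otimes>\<^bsub>A\<^esub> b\<^sup>\<star>\<^bsub>A\<^esub>) \<and>
     \<Delta> b = tens a b \<oplus>\<^bsub>T\<^esub> tens b (D \<otimes>\<^bsub>A\<^esub> a\<^sup>\<star>\<^bsub>A\<^esub>) \<and>
     \<Delta> D = tens D D"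

definition is_circle_quotient_map ::
    "'a cstar \<Rightarrow> 'a \<Rightarrow> 'a \<Rightarrow> 'a \<Rightarrow> ('a \<Rightarrow> complex \<Rightarrow> complex) \<Rightarrow> bool" where
  "is_circle_quotient_map A a b D \<psi> \<longleftrightarrow>
     star_hom A circle_algebra \<psi> \<and>
     \<psi> a = circle_gen \<and> \<psi> b = \<zero>\<^bsub>circle_algebra\<^esub> \<and> \<psi> D = \<one>\<^bsub>circle_algebra\<^esub>"

text \<open>
  \<open>\<psi>_id\<close> stands for the tensor product of \<open>\<psi>\<close> with the identity, with values in the algebra \<open>P\<close>
  whose elementary tensors are \<open>tensP\<close>.
\<close>

definition circle_quotient ::
    "'a cstar \<Rightarrow> ((complex \<Rightarrow> complex) \<Rightarrow> 'a \<Rightarrow> 'p) \<Rightarrow> ('a \<Rightarrow> 't) \<Rightarrow> ('t \<Rightarrow> 'p) \<Rightarrow> 'a set" where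
  "circle_quotient A tensP \<Delta> \<psi>_id =
     {x \<in> carrier A. \<psi>_id (\<Delta> x) = tensP \<one>\<^bsub>circle_algebra\<^esub> x}"

section \<open>Conditional expectations of index-finite type\<close>

locale conditional_expectation = unital_cstar_algebra A for A :: "'a cstar" (structure) +
  fixes B :: "'a set" and E :: "'a \<Rightarrow> 'a"
  assumes subalgebra: "unital_cstar_subalgebra A B"
    and range: "E \<in> carrier A \<rightarrow> B"
    and add: "\<lbrakk>x \<in> carrier A; y \<in> carrier A\<rbrakk> \<Longrightarrow> E (x \<oplus> y) = E x \<oplus> E y"
    and smult: "x \<in> carrier A \<Longrightarrow> E (c \<odot> x) = c \<odot> E x"
    and positive: "x \<in> carrier A \<Longrightarrow> \<exists>y\<in>carrier A. E (x\<^sup>\<star> \<otimes> x) = y\<^sup>\<star> \<otimes> y"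
    and id_on: "y \<in> B \<Longrightarrow> E y = y"
    and bimodule: "\<lbrakk>x \<in> carrier A; y \<in> B; z \<in> B\<rbrakk> \<Longrightarrow> E (y \<otimes> x \<otimes> z) = y \<otimes> E x \<otimes> z"

definition quasi_basis ::
    "'a cstar \<Rightarrow> ('a \<Rightarrow> 'a) \<Rightarrow> nat \<Rightarrow> (nat \<Rightarrow> 'a) \<Rightarrow> (nat \<Rightarrow> 'a) \<Rightarrow> bool" where
  "quasi_basis A E n u v \<longleftrightarrow>
     u \<in> {1..n} \<rightarrow> carrier A \<and> v \<in> {1..n} \<rightarrow> carrier A \<and>
     (\<forall>x\<in>carrier A.
        x = (\<Oplus>\<^bsub>A\<^esub>j\<in>{1..n}. u j \<otimes>\<^bsub>A\<^esub> E (v j \<otimes>\<^bsub>A\<^esub> x)) \<and>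
        x = (\<Oplus>\<^bsub>A\<^esub>j\<in>{1..n}. E (x \<otimes>\<^bsub>A\<^esub> u j) \<otimes>\<^bsub>A\<^esub> v j))"

definition index_finite_type :: "'a cstar \<Rightarrow> ('a \<Rightarrow> 'a) \<Rightarrow> bool" where
  "index_finite_type A E \<longleftrightarrow> (\<exists>n u v. quasi_basis A E n u v)"

end

theory Submission
  imports Defs "HOL-Library.Function_Algebras"
begin

text \<open>
  \<open>E\<^sub>\<psi>\<close> averages over the circle action under which \<open>a\<close> and \<open>b\<close> have degree \<open>1\<close> and \<open>D\<close> has
  degree \<open>0\<close>.  Since \<open>\<psi>\<close> sends an element of degree \<open>m\<close> to a multiple of \<open>z \<mapsto> z\<^sup>m\<close>, it is scalar
  on the range of \<open>E\<^sub>\<psi>\<close>: homogeneous elements span a dense subalgebra, and \<open>\<psi> \<circ> E\<^sub>\<psi>\<close> is bounded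
  because it is positive.  Applying \<open>\<psi>\<close> to the expansions of the powers \<open>a\<^sup>k\<close> in a quasi-basis
  \<open>(u\<^sub>j, v\<^sub>j)\<close> would then place all the functions \<open>z \<mapsto> z\<^sup>k\<close> in the span of the finitely many \<open>\<psi>(u\<^sub>j)\<close>.
\<close>

text \<open>The degrees come from \<open>\<psi> b = 0\<close>: modulo tensors with first leg
  \<open>b\<close>, \<open>\<Delta>\<close> sends \<open>a\<close>, \<open>b\<close>,
  \<open>D\<close> to \<open>tens a a\<close>, \<open>tens a b\<close>, \<open>tens D D\<close>, and
  \<open>\<psi>\<close> turns these first legs into the functions z, z and 1. Haar integration kills
  every nonzero degree, and on degree 0 the map \<open>\<psi>\<close> is constant. The obstacle is
  the passage from the dense subalgebra to all of \<open>A\<close>. Neither \<open>star_hom\<close>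
  nor \<open>conditional_expectation\<close> contains a norm bound, so continuity must be extracted
  from algebra. Evaluating \<open>\<psi> (E x)\<close> at a point of the circle gives a unital
  functional that is nonnegative on squares; a self-adjoint \<open>h\<close> of norm at most 1/2
  makes \<open>1 - h\<close> such a square, so the functional is at most 1 at \<open>h\<close> and
  at \<open>- h\<close>. This is why a square root is built first, from completeness alone. The
  resulting constant 4 is crude, but any finite constant serves the density argument.\<close>

section \<open>Norm estimates in unital C*-algebras\<close>

lemma complex_field_simps [simp]:
  "carrier complex_field = UNIV" "mult complex_field = (*)" "one complex_field = 1"
  "zero complex_field = 0" "add complex_field = (+)"
  by (simp_all add: complex_field_def)

context unital_cstar_algebra
begin

lemma scale_closed [simp, intro]: "x \<in> carrier A \<Longrightarrow> c \<odot> x \<in> carrier A"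
  using smult_closed[of c x] by simp

lemma scale_add_left: "x \<in> carrier A \<Longrightarrow> (c + d) \<odot> x = c \<odot> x \<oplus> d \<odot> x"
  using smult_l_distr[of c d x] by simp

lemma scale_add_right:
  "x \<in> carrier A \<Longrightarrow> y \<in> carrier A \<Longrightarrow> c \<odot> (x \<oplus> y) = c \<odot> x \<oplus> c \<odot> y"
  using smult_r_distr[of c x y] by simp

lemma scale_scale: "x \<in> carrier A \<Longrightarrow> c \<odot> (d \<odot> x) = (c * d) \<odot> x"
  using smult_assoc1[of c d x] by simp

lemma scale_one [simp]: "x \<in> carrier A \<Longrightarrow> 1 \<odot> x = x"
  using smult_one[of x] by simp

lemma scale_zero_left [simp]: "x \<in> carrier A \<Longrightarrow> 0 \<odot> x = \<zero>"
  using smult_l_null[of x] by simp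

lemma scale_zero_right [simp]: "c \<odot> \<zero> = \<zero>"
  using smult_r_null[of c] by simp

lemma minus_eq_scale: "x \<in> carrier A \<Longrightarrow> \<ominus> x = (- 1) \<odot> x"
  using scale_add_left[of x 1 "- 1"] by (simp add: A.minus_equality A.add.m_comm)

lemma diff_eq_scale: "\<lbrakk>x \<in> carrier A; y \<in> carrier A\<rbrakk> \<Longrightarrow> x \<ominus> y = x \<oplus> (- 1) \<odot> y"
  by (simp add: a_minus_def minus_eq_scale)

lemma norm_nonneg: "x \<in> carrier A \<Longrightarrow> 0 \<le> \<parallel>x\<parallel>"
  and norm_eq_zero: "x \<in> carrier A \<Longrightarrow> \<parallel>x\<parallel> = 0 \<longleftrightarrow> x = \<zero>"
  and norm_add: "\<lbrakk>x \<in> carrier A; y \<in> carrier A\<rbrakk> \<Longrightarrow> \<parallel>x \<oplus> y\<parallel> \<le> \<parallel>x\<parallel> + \<parallel>y\<parallel>"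
  and norm_scale: "x \<in> carrier A \<Longrightarrow> \<parallel>c \<odot> x\<parallel> = cmod c * \<parallel>x\<parallel>"
  and norm_mult: "\<lbrakk>x \<in> carrier A; y \<in> carrier A\<rbrakk> \<Longrightarrow> \<parallel>x \<otimes> y\<parallel> \<le> \<parallel>x\<parallel> * \<parallel>y\<parallel>"
  and norm_star_mult_self: "x \<in> carrier A \<Longrightarrow> \<parallel>x\<^sup>\<star> \<otimes> x\<parallel> = \<parallel>x\<parallel>\<^sup>2"
  using cstar_norm unfolding cstar_norm_on_def by auto

text \<open>The C*-identity and submultiplicativity bound the square of the norm of \<open>y\<close>
  by the product of the norms of its star and \<open>y\<close>; cancelling gives one inequality, and
  applying it to the star gives the other.\<close>

lemma norm_star [simp]:
  assumes "x \<in> carrier A"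
  shows "\<parallel>x\<^sup>\<star>\<parallel> = \<parallel>x\<parallel>"
proof -
  have le: "\<parallel>y\<parallel> \<le> \<parallel>y\<^sup>\<star>\<parallel>" if y: "y \<in> carrier A" for y
  proof (cases "\<parallel>y\<parallel> = 0")
    case True
    then show ?thesis using norm_nonneg[OF star_closed[OF y]] by simp
  next
    case False
    have "\<parallel>y\<parallel> * \<parallel>y\<parallel> \<le> \<parallel>y\<^sup>\<star>\<parallel> * \<parallel>y\<parallel>"
      using norm_mult[OF star_closed[OF y] y] norm_star_mult_self[OF y] by (simp add: power2_eq_square)
    then show ?thesis using False norm_nonneg[OF y] by simp
  qed
  show ?thesis
    using le[OF assms] le[OF star_closed[OF assms]] star_star[OF assms] by simp
qed

lemma star_diff: "\<lbrakk>x \<in> carrier A; y \<in> carrier A\<rbrakk> \<Longrightarrow> (x \<ominus> y)\<^sup>\<star> = x\<^sup>\<star> \<ominus> y\<^sup>\<star>"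
  by (simp add: diff_eq_scale star_add star_smult star_closed)

lemma star_one [simp]: "\<one>\<^sup>\<star> = \<one>"
proof -
  have "(\<one>\<^sup>\<star> \<otimes> \<one>)\<^sup>\<star> = (\<one>\<^sup>\<star>)\<^sup>\<star>" by (simp add: star_closed)
  then have "\<one>\<^sup>\<star> \<otimes> (\<one>\<^sup>\<star>)\<^sup>\<star> = (\<one>\<^sup>\<star>)\<^sup>\<star>"
    by (subst (asm) star_mult) (simp_all add: star_closed)
  then show ?thesis by (simp add: star_closed star_star)
qed

lemma norm_diff_sym: "\<lbrakk>x \<in> carrier A; y \<in> carrier A\<rbrakk> \<Longrightarrow> \<parallel>x \<ominus> y\<parallel> = \<parallel>y \<ominus> x\<parallel>"
  using norm_scale[of "x \<ominus> y" "- 1"]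
  by (simp add: diff_eq_scale scale_add_right scale_scale A.add.m_comm)

lemma norm_diff_triangle:
  assumes "x \<in> carrier A" "y \<in> carrier A" "z \<in> carrier A"
  shows "\<parallel>x \<ominus> z\<parallel> \<le> \<parallel>x \<ominus> y\<parallel> + \<parallel>y \<ominus> z\<parallel>"
proof -
  have "x \<ominus> z = (x \<ominus> y) \<oplus> (y \<ominus> z)" using assms by algebra
  then show ?thesis using norm_add[of "x \<ominus> y" "y \<ominus> z"] assms by simp
qed

lemma norm_add_diff:
  assumes "x \<in> carrier A" "y \<in> carrier A" "x' \<in> carrier A" "y' \<in> carrier A"
  shows "\<parallel>(x \<oplus> y) \<ominus> (x' \<oplus> y')\<parallel> \<le> \<parallel>x \<ominus> x'\<parallel> + \<parallel>y \<ominus> y'\<parallel>"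
proof -
  have "(x \<oplus> y) \<ominus> (x' \<oplus> y') = (x \<ominus> x') \<oplus> (y \<ominus> y')" using assms by algebra
  then show ?thesis using norm_add[of "x \<ominus> x'" "y \<ominus> y'"] assms by simp
qed

lemma norm_mult_diff:
  assumes "x \<in> carrier A" "y \<in> carrier A" "x' \<in> carrier A" "y' \<in> carrier A"
  shows "\<parallel>x \<otimes> y \<ominus> x' \<otimes> y'\<parallel> \<le> \<parallel>x\<parallel> * \<parallel>y \<ominus> y'\<parallel> + \<parallel>x \<ominus> x'\<parallel> * \<parallel>y'\<parallel>"
proof -
  have "x \<otimes> y \<ominus> x' \<otimes> y' = x \<otimes> (y \<ominus> y') \<oplus> (x \<ominus> x') \<otimes> y'" using assms by algebra
  then show ?thesis
    using norm_add[of "x \<otimes> (y \<ominus> y')" "(x \<ominus> x') \<otimes> y'"] norm_mult[of x "y \<ominus> y'"]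
      norm_mult[of "x \<ominus> x'" y'] assms by (simp add: A.minus_closed)
qed

lemma scale_diff:
  "\<lbrakk>x \<in> carrier A; y \<in> carrier A\<rbrakk> \<Longrightarrow> c \<odot> (x \<ominus> y) = c \<odot> x \<ominus> c \<odot> y"
  by (simp add: diff_eq_scale scale_add_right scale_scale)

lemma diff_eq_zero: "\<lbrakk>x \<in> carrier A; y \<in> carrier A\<rbrakk> \<Longrightarrow> x \<ominus> y = \<zero> \<longleftrightarrow> x = y"
  by (simp add: a_minus_def A.add.inv_solve_right')

text \<open>The square root of \<open>1 - h\<close> is \<open>1 - x\<close>, where \<open>x\<close> is the fixed point of the contraction
  \<open>x \<mapsto> (h + x\<^sup>2) / 2\<close> of the ball of radius \<open>1/2\<close>.\<close>

lemma ex_selfadjoint_sqrt: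
  assumes h: "h \<in> carrier A" "h\<^sup>\<star> = h" "\<parallel>h\<parallel> \<le> 1/2"
  shows "\<exists>k\<in>carrier A. k\<^sup>\<star> = k \<and> k \<otimes> k = \<one> \<ominus> h"
proof -
  define g where "g = (\<lambda>x. (1/2) \<odot> (h \<oplus> x \<otimes> x))"
  define r where "r = (\<lambda>n. (g ^^ n) \<zero>)"
  have g_closed: "g x \<in> carrier A" if "x \<in> carrier A" for x
    using that h by (simp add: g_def)
  \<comment> \<open>The factor is half of
    \<open>\<parallel>x\<parallel> + \<parallel>y\<parallel>\<close>, which is at most 1 on the ball
    of radius 1/2.\<close>
  have g_diff: "\<parallel>g x \<ominus> g y\<parallel> \<le> \<parallel>x \<ominus> y\<parallel> / 2"
    if x: "x \<in> carrier A" "\<parallel>x\<parallel> \<le> 1/2" and y: "y \<in> carrier A" "\<parallel>y\<parallel> \<le> 1/2" for x y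
  proof -
    have "g x \<ominus> g y = (1/2) \<odot> ((h \<oplus> x \<otimes> x) \<ominus> (h \<oplus> y \<otimes> y))"
      using x y h by (simp add: g_def scale_diff)
    also have "(h \<oplus> x \<otimes> x) \<ominus> (h \<oplus> y \<otimes> y) = x \<otimes> x \<ominus> y \<otimes> y"
      using x y h by algebra
    finally have "\<parallel>g x \<ominus> g y\<parallel> = \<parallel>x \<otimes> x \<ominus> y \<otimes> y\<parallel> / 2"
      using x y by (simp add: norm_scale norm_divide)
    moreover have "\<parallel>x \<otimes> x \<ominus> y \<otimes> y\<parallel> \<le> \<parallel>x\<parallel> * \<parallel>x \<ominus> y\<parallel> + \<parallel>x \<ominus> y\<parallel> * \<parallel>y\<parallel>"
      using norm_mult_diff x y by blast
    moreover have "\<parallel>x\<parallel> * \<parallel>x \<ominus> y\<parallel> \<le> (1/2) * \<parallel>x \<ominus> y\<parallel>" "\<parallel>x \<ominus> y\<parallel> * \<parallel>y\<parallel> \<le> \<parallel>x \<ominus> y\<parallel> * (1/2)"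
      using x y norm_nonneg[of "x \<ominus> y"]
      by (intro mult_right_mono mult_left_mono; simp)+
    ultimately show ?thesis by simp
  qed
  have g_norm: "\<parallel>g x\<parallel> \<le> 1/2" if x: "x \<in> carrier A" "\<parallel>x\<parallel> \<le> 1/2" for x
  proof -
    have "\<parallel>x \<otimes> x\<parallel> \<le> (1/2) * (1/2)"
      using norm_mult[of x x] mult_mono[of "\<parallel>x\<parallel>" "1/2" "\<parallel>x\<parallel>" "1/2"] x norm_nonneg[of x] by simp
    then show ?thesis
      using norm_add[of h "x \<otimes> x"] x h by (simp add: g_def norm_scale norm_divide)
  qed
  have r_Suc: "r (Suc n) = g (r n)" for n by (simp add: r_def)
  have r0: "r 0 = \<zero>" by (simp add: r_def)
  have zero_norm: "\<parallel>\<zero>\<parallel> = 0" by (simp add: norm_eq_zero)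
  have zero_star: "\<zero>\<^sup>\<star> = \<zero>"
    using norm_star[of \<zero>] norm_eq_zero[of "\<zero>\<^sup>\<star>"] zero_norm by (simp add: star_closed)
  \<comment> \<open>Self-adjointness is carried through the iteration so that the limit inherits it,
    the star being isometric.\<close>
  have r: "r n \<in> carrier A \<and> \<parallel>r n\<parallel> \<le> 1/2 \<and> (r n)\<^sup>\<star> = r n" for n
  proof (induction n)
    case 0
    then show ?case by (simp add: r0 zero_norm zero_star)
  next
    case (Suc n)
    then have "(g (r n))\<^sup>\<star> = g (r n)"
      using h by (simp add: g_def star_smult star_add star_mult)
    then show ?case using Suc g_closed g_norm by (simp add: r_Suc)
  qed
  \<comment> \<open>The bound is uniform in \<open>k\<close>: the base case only needs
    \<open>r k\<close> to lie in the ball, and each step halves the distance.\<close>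
  have r_diff: "\<parallel>r (n + k) \<ominus> r n\<parallel> \<le> (1/2) ^ n" for n k
  proof (induction n)
    case 0
    have "r k \<ominus> \<zero> = r k" using r[of k] by algebra
    then show ?case using r[of k] by (simp add: r0)
  next
    case (Suc n)
    then show ?case using g_diff[of "r (n + k)" "r n"] r by (simp add: r_Suc)
  qed
  have half: "(\<lambda>n. (1/2 :: real) ^ n) \<longlonglongrightarrow> 0" by (rule LIMSEQ_realpow_zero) auto
  have "\<exists>x\<in>carrier A. (\<lambda>n. \<parallel>r n \<ominus> x\<parallel>) \<longlonglongrightarrow> 0"
  proof (rule complete)
    fix e :: real assume "0 < e"
    then obtain M where M: "(1/2 :: real) ^ M < e / 2"
      using real_arch_pow_inv[of "e / 2" "1/2"] by auto
    have "\<parallel>r m \<ominus> r n\<parallel> < e" if mn: "M \<le> m" "M \<le> n" for m n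
    proof -
      have "\<parallel>r m \<ominus> r M\<parallel> < e / 2" "\<parallel>r n \<ominus> r M\<parallel> < e / 2"
        using r_diff[of M "m - M"] r_diff[of M "n - M"] mn M by auto
      then show ?thesis
        using norm_diff_triangle[of "r m" "r M" "r n"] norm_diff_sym[of "r n" "r M"] r by auto
    qed
    then show "\<exists>M. \<forall>m\<ge>M. \<forall>n\<ge>M. \<parallel>r m \<ominus> r n\<parallel> < e" by blast
  qed (use r in blast)
  then obtain x where x: "x \<in> carrier A" and lim: "(\<lambda>n. \<parallel>r n \<ominus> x\<parallel>) \<longlonglongrightarrow> 0" by blast
  \<comment> \<open>The limit has to stay in the ball, because \<open>g_diff\<close> is applied
    below to \<open>x\<close> and \<open>r n\<close>.\<close>
  have x_norm: "\<parallel>x\<parallel> \<le> 1/2"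
  proof (rule LIMSEQ_le_const)
    show "(\<lambda>n. 1/2 + \<parallel>r n \<ominus> x\<parallel>) \<longlonglongrightarrow> 1/2" using tendsto_add[OF tendsto_const lim] by simp
    have "\<parallel>x\<parallel> \<le> 1/2 + \<parallel>r n \<ominus> x\<parallel>" for n
    proof -
      have "x = r n \<oplus> (x \<ominus> r n)" using x r[of n] by algebra
      then have "\<parallel>x\<parallel> \<le> \<parallel>r n\<parallel> + \<parallel>x \<ominus> r n\<parallel>" using norm_add[of "r n" "x \<ominus> r n"] x r[of n] by simp
      then show ?thesis using norm_diff_sym[of x "r n"] x r[of n] by simp
    qed
    then show "\<exists>N. \<forall>n\<ge>N. \<parallel>x\<parallel> \<le> 1/2 + \<parallel>r n \<ominus> x\<parallel>" by blast
  qed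
  have gx: "g x = x"
  proof -
    have "\<parallel>g x \<ominus> x\<parallel> \<le> 0"
    proof (rule LIMSEQ_le_const)
      show "(\<lambda>n. \<parallel>r n \<ominus> x\<parallel> / 2 + \<parallel>r (Suc n) \<ominus> x\<parallel>) \<longlonglongrightarrow> 0"
        using tendsto_add[OF tendsto_divide[OF lim tendsto_const[of 2]] LIMSEQ_Suc[OF lim]] by simp
      have "\<parallel>g x \<ominus> x\<parallel> \<le> \<parallel>r n \<ominus> x\<parallel> / 2 + \<parallel>r (Suc n) \<ominus> x\<parallel>" for n
        using norm_diff_triangle[of "g x" "r (Suc n)" x] g_diff[of x "r n"] r[of n] x x_norm g_closed
          norm_diff_sym[of x "r n"] by (simp add: r_Suc)
      then show "\<exists>N. \<forall>n\<ge>N. \<parallel>g x \<ominus> x\<parallel> \<le> \<parallel>r n \<ominus> x\<parallel> / 2 + \<parallel>r (Suc n) \<ominus> x\<parallel>" by blast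
    qed
    then show ?thesis
      using norm_nonneg[of "g x \<ominus> x"] norm_eq_zero[of "g x \<ominus> x"] x g_closed
      by (simp add: diff_eq_zero)
  qed
  have x_star: "x\<^sup>\<star> = x"
  proof -
    have "\<parallel>x\<^sup>\<star> \<ominus> x\<parallel> \<le> 0"
    proof (rule LIMSEQ_le_const)
      show "(\<lambda>n. \<parallel>r n \<ominus> x\<parallel> + \<parallel>r n \<ominus> x\<parallel>) \<longlonglongrightarrow> 0"
        using tendsto_add[OF lim lim] by simp
      have "\<parallel>x\<^sup>\<star> \<ominus> x\<parallel> \<le> \<parallel>r n \<ominus> x\<parallel> + \<parallel>r n \<ominus> x\<parallel>" for n
        using norm_diff_triangle[of "x\<^sup>\<star>" "r n" x] norm_star[of "r n \<ominus> x"] star_diff[of "r n" x]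
          norm_diff_sym[of "x\<^sup>\<star>" "r n"] r[of n] x star_closed by simp
      then show "\<exists>N. \<forall>n\<ge>N. \<parallel>x\<^sup>\<star> \<ominus> x\<parallel> \<le> \<parallel>r n \<ominus> x\<parallel> + \<parallel>r n \<ominus> x\<parallel>" by blast
    qed
    then show ?thesis
      using norm_nonneg[of "x\<^sup>\<star> \<ominus> x"] norm_eq_zero[of "x\<^sup>\<star> \<ominus> x"] x star_closed
      by (simp add: diff_eq_zero)
  qed
  \<comment> \<open>This is the fixed point equation multiplied by 2; it is what makes the square of
    \<open>1 - x\<close> equal to \<open>1 - h\<close>.\<close>
  have "x \<oplus> x = h \<oplus> x \<otimes> x"
    using gx x h scale_add_left[of x 1 1] scale_scale[of "h \<oplus> x \<otimes> x" 2 "1/2"] by (simp add: g_def)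
  then have *: "x \<otimes> x = x \<oplus> x \<ominus> h" using x h by (metis A.add.inv_solve_right' A.add.m_comm A.m_closed A.add.m_closed a_minus_def)
  have "(\<one> \<ominus> x) \<otimes> (\<one> \<ominus> x) = \<one> \<ominus> (x \<oplus> x) \<oplus> x \<otimes> x"
    using x by (simp add: A.ring_simprules a_minus_def)
  also have "\<dots> = \<one> \<ominus> h" unfolding * using x h by algebra
  finally have "(\<one> \<ominus> x) \<otimes> (\<one> \<ominus> x) = \<one> \<ominus> h" .
  then show ?thesis
    using x x_star by (intro bexI[of _ "\<one> \<ominus> x"]) (auto simp: star_diff)
qed

end

section \<open>Closures and bounded linear maps\<close>

context unital_cstar_algebra
begin

lemma norm_le_add_diff:
  assumes "x \<in> carrier A" "y \<in> carrier A"
  shows "\<parallel>y\<parallel> \<le> \<parallel>x\<parallel> + \<parallel>x \<ominus> y\<parallel>"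
proof -
  have "y = x \<oplus> (y \<ominus> x)" using assms by algebra
  then show ?thesis
    using norm_add[of x "y \<ominus> x"] norm_diff_sym[of x y] assms by simp
qed

lemma cstar_closure_cstar_subalgebra:
  assumes S: "unital_star_subalgebra A S"
  shows "unital_cstar_subalgebra A (cstar_closure A S)"
proof -
  let ?C = "cstar_closure A S"
  have S_carrier: "S \<subseteq> carrier A" and S_one: "\<one> \<in> S"
    and S_add: "\<And>x y. x \<in> S \<Longrightarrow> y \<in> S \<Longrightarrow> x \<oplus> y \<in> S"
    and S_mult: "\<And>x y. x \<in> S \<Longrightarrow> y \<in> S \<Longrightarrow> x \<otimes> y \<in> S"
    and S_scale: "\<And>c x. x \<in> S \<Longrightarrow> c \<odot> x \<in> S"
    and S_star: "\<And>x. x \<in> S \<Longrightarrow> x\<^sup>\<star> \<in> S"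
    using S unfolding unital_star_subalgebra_def by auto
  have C_carrier: "x \<in> carrier A" if "x \<in> ?C" for x
    using that by (simp add: cstar_closure_def)
  have C_approx: "\<exists>y\<in>S. y \<in> carrier A \<and> \<parallel>x \<ominus> y\<parallel> < e" if "x \<in> ?C" "0 < e" for x e
    using that S_carrier unfolding cstar_closure_def by blast
  have C_I: "x \<in> ?C" if "x \<in> carrier A" "\<And>e. 0 < e \<Longrightarrow> \<exists>y\<in>S. \<parallel>x \<ominus> y\<parallel> < e" for x
    using that by (auto simp: cstar_closure_def)
  have diff_self: "\<parallel>x \<ominus> x\<parallel> = 0" if "x \<in> carrier A" for x
    using that by (simp add: diff_eq_zero norm_eq_zero)
  have sub: "x \<in> ?C" if "x \<in> S" for x
    using that S_carrier diff_self by (intro C_I) (auto intro!: bexI[of _ x])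
  have add: "x \<oplus> y \<in> ?C" if x: "x \<in> ?C" and y: "y \<in> ?C" for x y
  proof (rule C_I)
    fix e :: real assume "0 < e"
    then obtain x' y' where "x' \<in> S" "x' \<in> carrier A" "\<parallel>x \<ominus> x'\<parallel> < e/2"
      and "y' \<in> S" "y' \<in> carrier A" "\<parallel>y \<ominus> y'\<parallel> < e/2"
      using C_approx[OF x, of "e/2"] C_approx[OF y, of "e/2"] by auto
    then show "\<exists>z\<in>S. \<parallel>x \<oplus> y \<ominus> z\<parallel> < e"
      using norm_add_diff[of x y x' y'] C_carrier x y S_add by (intro bexI[of _ "x' \<oplus> y'"]) auto
  qed (use C_carrier x y in simp)
  have mult: "x \<otimes> y \<in> ?C" if x: "x \<in> ?C" and y: "y \<in> ?C" for x y
  proof (rule C_I)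
    fix e :: real assume e: "0 < e"
    \<comment> \<open>The product error is at most \<open>\<parallel>x\<parallel> * d + d *
      (\<parallel>y\<parallel> + 1)\<close>, that is \<open>d * (M - 1)\<close>; one unit of the
      summand 2 in \<open>M\<close> is spare and makes the final inequality strict. The cap
      \<open>d \<le> 1\<close> bounds the norm of \<open>y'\<close>.\<close>
    define M where "M = \<parallel>x\<parallel> + \<parallel>y\<parallel> + 2"
    have nn: "0 \<le> \<parallel>x\<parallel>" "0 \<le> \<parallel>y\<parallel>" using norm_nonneg C_carrier x y by auto
    then have M: "0 < M" by (simp add: M_def)
    define d where "d = min 1 (e / M)"
    have d: "0 < d" "d \<le> 1" "d * M \<le> e"
      using e M by (auto simp: d_def min_def field_simps)
    obtain x' y' where x': "x' \<in> S" "x' \<in> carrier A" "\<parallel>x \<ominus> x'\<parallel> < d"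
      and y': "y' \<in> S" "y' \<in> carrier A" "\<parallel>y \<ominus> y'\<parallel> < d"
      using C_approx[OF x, of d] C_approx[OF y, of d] d by auto
    have "\<parallel>y'\<parallel> \<le> \<parallel>y\<parallel> + 1" using norm_le_add_diff[of y y'] C_carrier[OF y] y' d by simp
    then have "\<parallel>x \<ominus> x'\<parallel> * \<parallel>y'\<parallel> \<le> d * (\<parallel>y\<parallel> + 1)"
      using x' d C_carrier[OF x] y' norm_nonneg by (intro mult_mono) auto
    moreover have "\<parallel>x\<parallel> * \<parallel>y \<ominus> y'\<parallel> \<le> \<parallel>x\<parallel> * d"
      using y' nn by (intro mult_left_mono) auto
    ultimately have "\<parallel>x \<otimes> y \<ominus> x' \<otimes> y'\<parallel> \<le> d * M - d"
      using norm_mult_diff[of x y x' y'] C_carrier x y x' y' by (simp add: M_def algebra_simps)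
    then have "\<parallel>x \<otimes> y \<ominus> x' \<otimes> y'\<parallel> < e" using d by simp
    then show "\<exists>z\<in>S. \<parallel>x \<otimes> y \<ominus> z\<parallel> < e" using S_mult x' y' by blast
  qed (use C_carrier x y in simp)
  have scale: "c \<odot> x \<in> ?C" if x: "x \<in> ?C" for c x
  proof (rule C_I)
    fix e :: real assume e: "0 < e"
    have pos: "0 < cmod c + 1" by (simp add: add_nonneg_pos)
    obtain x' where x': "x' \<in> S" "x' \<in> carrier A" "\<parallel>x \<ominus> x'\<parallel> < e / (cmod c + 1)"
      using C_approx[OF x, of "e / (cmod c + 1)"] e pos by auto
    have "\<parallel>c \<odot> x \<ominus> c \<odot> x'\<parallel> = cmod c * \<parallel>x \<ominus> x'\<parallel>"
      using C_carrier[OF x] x' by (simp add: norm_scale flip: scale_diff)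
    also have "\<dots> \<le> (cmod c + 1) * \<parallel>x \<ominus> x'\<parallel>"
      using norm_nonneg[of "x \<ominus> x'"] C_carrier[OF x] x' by (simp add: mult_right_mono)
    also have "\<dots> < e" using x' pos by (simp add: field_simps)
    finally show "\<exists>z\<in>S. \<parallel>c \<odot> x \<ominus> z\<parallel> < e" using S_scale x' by blast
  qed (use C_carrier x in simp)
  have star: "x\<^sup>\<star> \<in> ?C" if x: "x \<in> ?C" for x
  proof (rule C_I)
    fix e :: real assume "0 < e"
    then obtain x' where x': "x' \<in> S" "x' \<in> carrier A" "\<parallel>x \<ominus> x'\<parallel> < e"
      using C_approx[OF x] by auto
    then show "\<exists>z\<in>S. \<parallel>x\<^sup>\<star> \<ominus> z\<parallel> < e"
      using norm_star[of "x \<ominus> x'"] C_carrier[OF x] S_star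
      by (intro bexI[of _ "x'\<^sup>\<star>"]) (simp_all add: star_diff)
  qed (use C_carrier x star_closed in simp)
  have idem: "cstar_closure A ?C = ?C"
  proof
    show "cstar_closure A ?C \<subseteq> ?C"
    proof
      fix x assume x: "x \<in> cstar_closure A ?C"
      then have x_carrier: "x \<in> carrier A" by (simp add: cstar_closure_def)
      show "x \<in> ?C"
      proof (rule C_I[OF x_carrier])
        fix e :: real assume e: "0 < e"
        then obtain y where y: "y \<in> ?C" "\<parallel>x \<ominus> y\<parallel> < e/2"
          using x unfolding cstar_closure_def[of A ?C] by (auto dest: spec[of _ "e/2"])
        obtain z where "z \<in> S" "z \<in> carrier A" "\<parallel>y \<ominus> z\<parallel> < e/2"
          using C_approx[OF y(1), of "e/2"] e by auto
        then show "\<exists>z\<in>S. \<parallel>x \<ominus> z\<parallel> < e"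
          using norm_diff_triangle[of x y z] y C_carrier x_carrier by (intro bexI[of _ z]) auto
      qed
    qed
    show "?C \<subseteq> cstar_closure A ?C"
    proof
      fix x assume "x \<in> ?C"
      then show "x \<in> cstar_closure A ?C"
        using C_carrier[of x] diff_self[of x] unfolding cstar_closure_def[of A ?C]
        by (auto intro!: bexI[of _ x])
    qed
  qed
  show ?thesis
    unfolding unital_cstar_subalgebra_def unital_star_subalgebra_def
    by (intro conjI ballI allI subsetI) (simp_all only: C_carrier sub[OF S_one] add mult scale star idem)
qed

text \<open>Generation is defined as an intersection and offers no approximants. The closure of a
  *-subalgebra containing the generators is a member of that intersected family, which yields
  density.\<close>

lemma cstar_generated_subset_closure:
  assumes "unital_star_subalgebra A S" "G \<subseteq> S"
  shows "cstar_generated A G \<subseteq> cstar_closure A S"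
proof -
  have "S \<subseteq> carrier A" using assms(1) by (simp add: unital_star_subalgebra_def)
  have "S \<subseteq> cstar_closure A S"
  proof
    fix x assume x: "x \<in> S"
    then have "x \<in> carrier A" using \<open>S \<subseteq> carrier A\<close> by blast
    then have "x \<in> carrier A \<and> \<parallel>x \<ominus> x\<parallel> = 0" by (simp add: diff_eq_zero norm_eq_zero)
    then show "x \<in> cstar_closure A S" using x unfolding cstar_closure_def by force
  qed
  then show ?thesis
    using cstar_closure_cstar_subalgebra[OF assms(1)] assms(2)
    unfolding cstar_generated_def by blast
qed

lemma bounded_linear_map_mult_left:
  assumes "p \<in> carrier A"
  shows "bounded_linear_map A A (\<lambda>x. p \<otimes> x)"
  unfolding bounded_linear_map_def
  using assms norm_mult[of p] by (auto simp: A.r_distr smult_mult_right)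

lemma bounded_linear_map_mult_right:
  assumes "p \<in> carrier A"
  shows "bounded_linear_map A A (\<lambda>x. x \<otimes> p)"
  unfolding bounded_linear_map_def
  using assms norm_mult[of _ p]
  by (auto simp: A.l_distr smult_mult_left mult.commute intro!: exI[of _ "\<parallel>p\<parallel>"])

end


lemma bounded_linear_map_comp:
  assumes B: "unital_cstar_algebra B"
    and F: "bounded_linear_map A B F" and G: "bounded_linear_map B C G"
  shows "bounded_linear_map A C (\<lambda>x. G (F x))"
proof -
  interpret B: unital_cstar_algebra B by (rule B)
  obtain K L where K: "\<And>x. x \<in> carrier A \<Longrightarrow> \<parallel>F x\<parallel>\<^bsub>B\<^esub> \<le> K * \<parallel>x\<parallel>\<^bsub>A\<^esub>"
    and L: "\<And>x. x \<in> carrier B \<Longrightarrow> \<parallel>G x\<parallel>\<^bsub>C\<^esub> \<le> L * \<parallel>x\<parallel>\<^bsub>B\<^esub>"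
    using F G unfolding bounded_linear_map_def by metis
  have F': "F x \<in> carrier B" if "x \<in> carrier A" for x
    using F that unfolding bounded_linear_map_def by blast
  \<comment> \<open>The constant \<open>L\<close> from the definition has no prescribed sign, hence
    the absolute value.\<close>
  have "\<parallel>G (F x)\<parallel>\<^bsub>C\<^esub> \<le> (\<bar>L\<bar> * K) * \<parallel>x\<parallel>\<^bsub>A\<^esub>" if x: "x \<in> carrier A" for x
  proof -
    have "\<parallel>G (F x)\<parallel>\<^bsub>C\<^esub> \<le> \<bar>L\<bar> * \<parallel>F x\<parallel>\<^bsub>B\<^esub>"
      using L[OF F'[OF x]] mult_right_mono[OF abs_ge_self B.norm_nonneg[OF F'[OF x]], of L] by linarith
    also have "\<dots> \<le> \<bar>L\<bar> * (K * \<parallel>x\<parallel>\<^bsub>A\<^esub>)" using K[OF x] by (intro mult_left_mono) auto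
    finally show ?thesis by (simp add: mult.assoc)
  qed
  moreover have "(\<lambda>x. G (F x)) \<in> carrier A \<rightarrow> carrier C"
    "\<forall>x\<in>carrier A. \<forall>y\<in>carrier A. G (F (x \<oplus>\<^bsub>A\<^esub> y)) = G (F x) \<oplus>\<^bsub>C\<^esub> G (F y)"
    "\<forall>c. \<forall>x\<in>carrier A. G (F (c \<odot>\<^bsub>A\<^esub> x)) = c \<odot>\<^bsub>C\<^esub> G (F x)"
    using F G F' unfolding bounded_linear_map_def by (auto simp: Pi_iff)
  ultimately show ?thesis
    unfolding bounded_linear_map_def by blast
qed

text \<open>If \<open>s\<close> in \<open>S\<close> is close to \<open>x\<close>, then
  \<open>F x\<close> equals \<open>F\<close> of the small difference. No linear structure on
  \<open>S\<close> is involved, so it may be any set with \<open>x\<close> in its closure.\<close>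

lemma bounded_linear_map_eq_zero:
  assumes A: "unital_cstar_algebra A" and B: "unital_cstar_algebra B"
    and F: "bounded_linear_map A B F"
    and S: "S \<subseteq> carrier A" "\<And>s. s \<in> S \<Longrightarrow> F s = \<zero>\<^bsub>B\<^esub>"
    and x: "x \<in> cstar_closure A S"
  shows "F x = \<zero>\<^bsub>B\<^esub>"
proof -
  interpret A: unital_cstar_algebra A by (rule A)
  interpret B: unital_cstar_algebra B by (rule B)
  obtain K where K: "\<And>x. x \<in> carrier A \<Longrightarrow> \<parallel>F x\<parallel>\<^bsub>B\<^esub> \<le> K * \<parallel>x\<parallel>\<^bsub>A\<^esub>"
    using F unfolding bounded_linear_map_def by blast
  have F_closed: "F y \<in> carrier B" if "y \<in> carrier A" for y
    using F that unfolding bounded_linear_map_def by blast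
  have x_carrier: "x \<in> carrier A" using x by (simp add: cstar_closure_def)
  have "\<parallel>F x\<parallel>\<^bsub>B\<^esub> \<le> 0 + e" if e: "0 < e" for e
  proof -
    have pos: "0 < \<bar>K\<bar> + 1" by simp
    obtain s where s: "s \<in> S" "\<parallel>x \<ominus>\<^bsub>A\<^esub> s\<parallel>\<^bsub>A\<^esub> < e / (\<bar>K\<bar> + 1)"
      using x e pos unfolding cstar_closure_def by (auto dest: spec[of _ "e / (\<bar>K\<bar> + 1)"])
    have s_carrier: "s \<in> carrier A" using s S by auto
    have d_carrier: "x \<ominus>\<^bsub>A\<^esub> s \<in> carrier A" using x_carrier s_carrier by simp
    have "x = (x \<ominus>\<^bsub>A\<^esub> s) \<oplus>\<^bsub>A\<^esub> s" using x_carrier s_carrier by algebra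
    moreover have "F ((x \<ominus>\<^bsub>A\<^esub> s) \<oplus>\<^bsub>A\<^esub> s) = F (x \<ominus>\<^bsub>A\<^esub> s) \<oplus>\<^bsub>B\<^esub> F s"
      using F d_carrier s_carrier unfolding bounded_linear_map_def by blast
    ultimately have "F x = F (x \<ominus>\<^bsub>A\<^esub> s) \<oplus>\<^bsub>B\<^esub> F s" by simp
    also have "\<dots> = F (x \<ominus>\<^bsub>A\<^esub> s)"
      using S(2)[OF s(1)] F_closed[of "x \<ominus>\<^bsub>A\<^esub> s"] x_carrier s_carrier by simp
    finally have "\<parallel>F x\<parallel>\<^bsub>B\<^esub> \<le> K * \<parallel>x \<ominus>\<^bsub>A\<^esub> s\<parallel>\<^bsub>A\<^esub>"
      using K[of "x \<ominus>\<^bsub>A\<^esub> s"] x_carrier s_carrier by simp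
    also have "\<dots> \<le> (\<bar>K\<bar> + 1) * \<parallel>x \<ominus>\<^bsub>A\<^esub> s\<parallel>\<^bsub>A\<^esub>"
      using A.norm_nonneg[of "x \<ominus>\<^bsub>A\<^esub> s"] x_carrier s_carrier by (intro mult_right_mono) auto
    also have "\<dots> \<le> e" using s(2) pos by (simp add: field_simps)
    finally show ?thesis by simp
  qed
  then have "\<parallel>F x\<parallel>\<^bsub>B\<^esub> \<le> 0" by (rule field_le_epsilon)
  then show ?thesis
    using B.norm_nonneg[of "F x"] B.norm_eq_zero[of "F x"] F_closed[OF x_carrier] by simp
qed

section \<open>The circle algebra\<close>

lemma circle_algebra_simps [simp]:
  "mult circle_algebra = (\<lambda>f g z. f z * g z)" "add circle_algebra = (\<lambda>f g z. f z + g z)"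
  "zero circle_algebra = (\<lambda>_. 0)" "one circle_algebra = circle_fun (\<lambda>_. 1)"
  "smult circle_algebra = (\<lambda>c f z. c * f z)" "star circle_algebra = (\<lambda>f z. cnj (f z))"
  by (simp_all add: circle_algebra_def)

context
  fixes A :: "'a cstar" and \<psi> :: "'a \<Rightarrow> complex \<Rightarrow> complex"
  assumes \<psi>: "star_hom A circle_algebra \<psi>"
begin

lemma circle_hom_add: "\<lbrakk>x \<in> carrier A; y \<in> carrier A\<rbrakk> \<Longrightarrow> \<psi> (x \<oplus>\<^bsub>A\<^esub> y) z = \<psi> x z + \<psi> y z"
  and circle_hom_mult: "\<lbrakk>x \<in> carrier A; y \<in> carrier A\<rbrakk> \<Longrightarrow> \<psi> (x \<otimes>\<^bsub>A\<^esub> y) z = \<psi> x z * \<psi> y z"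
  and circle_hom_scale: "x \<in> carrier A \<Longrightarrow> \<psi> (c \<odot>\<^bsub>A\<^esub> x) z = c * \<psi> x z"
  and circle_hom_star: "x \<in> carrier A \<Longrightarrow> \<psi> (x\<^sup>\<star>\<^bsub>A\<^esub>) z = cnj (\<psi> x z)"
  and circle_hom_one: "\<psi> \<one>\<^bsub>A\<^esub> = circle_fun (\<lambda>_. 1)"
  using \<psi> unfolding star_hom_def ring_hom_def by simp_all

lemma circle_hom_finsum:
  assumes "unital_cstar_algebra A" "finite I" "x \<in> I \<rightarrow> carrier A"
  shows "\<psi> (\<Oplus>\<^bsub>A\<^esub>i\<in>I. x i) z = (\<Sum>i\<in>I. \<psi> (x i) z)"
proof -
  interpret unital_cstar_algebra A by (rule assms)
  have zero: "\<psi> \<zero>\<^bsub>A\<^esub> z = 0" using circle_hom_scale[of "\<zero>\<^bsub>A\<^esub>" 0 z] by simp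
  show ?thesis
    using assms(2,3) by (induction I rule: finite_induct) (simp_all add: zero circle_hom_add Pi_iff)
qed

end

text \<open>Along the parametrization \<open>f\<close> becomes \<open>exp (w * s)\<close> with
  \<open>w = 2 * pi * \<i> * m\<close> nonzero; its antiderivative \<open>exp (w * s) / w\<close>
  has period 1.\<close>

lemma circle_haar_power_int:
  assumes f: "\<And>z. z \<in> sphere 0 1 \<Longrightarrow> f z = z powi m" and m: "m \<noteq> 0"
  shows "circle_haar f = 0"
proof -
  define w where "w = 2 * pi * \<i> * of_int m"
  have w: "w \<noteq> 0" using m by (simp add: w_def)
  have eq: "f (cis (2 * pi * s)) = exp (w * of_real s)" for s
  proof -
    have "f (cis (2 * pi * s)) = exp (\<i> * of_real (2 * pi * s)) powi m" by (simp add: f cis_conv_exp)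
    also have "\<dots> = exp (w * of_real s)"
      by (simp add: w_def exp_power_int algebra_simps)
    finally show ?thesis .
  qed
  have "((\<lambda>s. exp (w * of_real s)) has_integral (exp (w * of_real 1) / w - exp (w * of_real 0) / w)) {0..1}"
    using w by (intro fundamental_theorem_of_calculus)
      (auto intro!: derivative_eq_intros has_vector_derivative_real_field)
  moreover have "exp w = 1"
    unfolding w_def using exp_integer_2pi[of "of_int m"] by (simp add: algebra_simps)
  ultimately have "((\<lambda>s. exp (w * of_real s)) has_integral 0) {0..1}" by simp
  then show ?thesis
    unfolding circle_haar_def eq by (rule integral_unique)
qed

text \<open>A finite connected set has at most one point, while the circle contains both 1 and
  -1.\<close>

lemma infinite_unit_circle: "infinite (sphere 0 1 :: complex set)"
proof
  assume "finite (sphere 0 1 :: complex set)"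
  then have "sphere 0 1 = ({} :: complex set) \<or> (\<exists>x :: complex. sphere 0 1 = {x})"
    by (subst (asm) connected_finite_iff_sing) (auto intro: connected_sphere)
  moreover have "(1 :: complex) \<in> sphere 0 1" "(- 1 :: complex) \<in> sphere 0 1" by simp_all
  ultimately show False by (metis empty_iff neg_equal_iff_equal one_neq_neg_one singletonD)
qed

lemma circle_powers_independent:
  fixes u :: "nat \<Rightarrow> complex"
  assumes "\<And>z. z \<in> sphere 0 1 \<Longrightarrow> (\<Sum>k\<le>n. u k * z ^ k) = 0" "k \<le> n"
  shows "u k = 0"
proof (rule ccontr)
  assume "u k \<noteq> 0"
  then have "finite {z. (\<Sum>i\<le>n. u i * z ^ i) = 0}"
    using assms(2) by (subst polyfun_finite_roots) auto
  moreover have "sphere 0 1 \<subseteq> {z. (\<Sum>i\<le>n. u i * z ^ i) = 0}" using assms(1) by auto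
  ultimately show False using infinite_unit_circle finite_subset by blast
qed

text \<open>The coefficients \<open>c k j\<close> do not depend on \<open>z\<close>, so
  \<open>card J + 1\<close> independent powers would lie in the span of \<open>card J\<close>
  functions.\<close>

lemma circle_powers_not_in_span:
  fixes U :: "'i \<Rightarrow> complex \<Rightarrow> complex"
  assumes J: "finite J"
    and eq: "\<And>k z. z \<in> sphere 0 1 \<Longrightarrow> z ^ k = (\<Sum>j\<in>J. c k j * U j z)"
  shows False
proof -
  interpret V: vector_space "\<lambda>(c :: complex) (f :: complex \<Rightarrow> complex) z. c * f z"
    by unfold_locales (auto simp: fun_eq_iff algebra_simps)
  define n where "n = card J"
  \<comment> \<open>The equations hold only on the circle, so all functions are cut off to zero
    outside it before they are compared as vectors.\<close>
  define f where "f = (\<lambda>(k::nat). circle_fun (\<lambda>z. z ^ k))"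
  \<comment> \<open>Independence is a property of sets and cardinalities count distinct functions,
    so the powers must be pairwise different on the circle.\<close>
  have inj: "inj f"
  proof (rule injI, rule ccontr)
    fix k l assume kl: "f k = f l" "k \<noteq> l"
    define u :: "nat \<Rightarrow> complex" where "u i = of_bool (i = k) - of_bool (i = l)" for i
    have "u k = 0"
    proof (rule circle_powers_independent[of u "max k l"])
      fix z :: complex assume z: "z \<in> sphere 0 1"
      have "(\<Sum>i\<le>max k l. u i * z ^ i) = z ^ k - z ^ l"
        by (simp add: u_def left_diff_distrib sum_subtractf of_bool_def if_distrib[of "\<lambda>x. x * _"] sum.delta' cong: if_cong)
      also have "\<dots> = 0" using fun_cong[OF kl(1), of z] z by (simp add: f_def circle_fun_def)
      finally show "(\<Sum>i\<le>max k l. u i * z ^ i) = 0" .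
    qed simp
    then show False using kl by (simp add: u_def)
  qed
  have "f ` {..n} \<subseteq> V.span ((\<lambda>j. circle_fun (U j)) ` J)"
  proof (intro image_subsetI)
    fix k
    have f_eq: "f k = (\<Sum>j\<in>J. (\<lambda>z. c k j * circle_fun (U j) z))"
    proof
      fix z
      have "(\<Sum>j\<in>J. (\<lambda>z. c k j * circle_fun (U j) z)) z = (\<Sum>j\<in>J. c k j * circle_fun (U j) z)"
        using J by (induction J rule: finite_induct) simp_all
      then show "f k z = (\<Sum>j\<in>J. (\<lambda>z. c k j * circle_fun (U j) z)) z"
        using eq[of z k] by (simp add: f_def circle_fun_def)
    qed
    show "f k \<in> V.span ((\<lambda>j. circle_fun (U j)) ` J)"
      unfolding f_eq by (rule V.span_sum, rule V.span_scale, rule V.span_base, rule imageI)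
  qed
  moreover have "V.independent (f ` {..n})"
    unfolding V.dependent_finite[OF finite_imageI[OF finite_atMost]]
  proof (rule notI, elim exE conjE bexE imageE)
    fix u v k
    assume u: "(\<Sum>v\<in>f ` {..n}. (\<lambda>z. u v * v z)) = 0" and k: "k \<in> {..n}" "v = f k" "u v \<noteq> 0"
    have "u (f k) = 0"
    proof (rule circle_powers_independent[of "\<lambda>k. u (f k)" n])
      fix z :: complex assume z: "z \<in> sphere 0 1"
      have "(\<Sum>k\<le>n. u (f k) * z ^ k) = (\<Sum>k\<le>n. u (f k) * f k z)"
        using z by (simp add: f_def circle_fun_def)
      also have "\<dots> = (\<Sum>k\<le>n. (\<lambda>z. u (f k) * f k z)) z"
        by (induction n) simp_all
      also have "\<dots> = (\<Sum>v\<in>f ` {..n}. (\<lambda>z. u v * v z)) z"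
        using sum.reindex[OF inj_on_subset[OF inj subset_UNIV], of "\<lambda>v z. u v * v z" "{..n}"]
        by (simp add: comp_def)
      finally show "(\<Sum>k\<le>n. u (f k) * z ^ k) = 0" by (simp add: u)
    qed (use k in simp)
    then show False using k by simp
  qed
  ultimately have "card (f ` {..n}) \<le> card ((\<lambda>j. circle_fun (U j)) ` J)"
    using V.independent_span_bound J by blast
  also have "\<dots> \<le> n" unfolding n_def using J by (rule card_image_le)
  finally show False using card_image[OF inj_on_subset[OF inj, of "{..n}"]] by simp
qed

section \<open>Positivity of the conditional expectation\<close>

context conditional_expectation
begin

lemma E_closed: "x \<in> carrier A \<Longrightarrow> E x \<in> carrier A"
  using range subalgebra
  unfolding unital_cstar_subalgebra_def unital_star_subalgebra_def by blast

lemma E_one: "E \<one> = \<one>"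
  using id_on subalgebra
  unfolding unital_cstar_subalgebra_def unital_star_subalgebra_def by blast

text \<open>Positivity of \<open>E\<close> turns into nonnegativity of a number, since
  \<open>\<psi>\<close> maps \<open>y\<^sup>\<star> \<otimes> y\<close> to the squared modulus of
  \<open>\<psi> y\<close>. The constant 4 is a factor 2 from rescaling to norm 1/2, times 2 from
  splitting into self-adjoint parts.\<close>

lemma norm_circle_hom_E_le:
  assumes \<psi>: "star_hom A circle_algebra \<psi>" and x: "x \<in> carrier A" and z: "z \<in> sphere 0 1"
  shows "cmod (\<psi> (E x) z) \<le> 4 * \<parallel>x\<parallel>"
proof -
  define \<omega> where "\<omega> = (\<lambda>y. \<psi> (E y) z)"
  have \<omega>_add: "\<omega> (y \<oplus> y') = \<omega> y + \<omega> y'" if "y \<in> carrier A" "y' \<in> carrier A" for y y'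
    using that by (simp add: \<omega>_def add E_closed circle_hom_add[OF \<psi>])
  have \<omega>_scale: "\<omega> (c \<odot> y) = c * \<omega> y" if "y \<in> carrier A" for c y
    using that by (simp add: \<omega>_def smult E_closed circle_hom_scale[OF \<psi>])
  have \<omega>_one: "\<omega> \<one> = 1"
    using z by (simp add: \<omega>_def E_one circle_hom_one[OF \<psi>] circle_fun_def)
  \<comment> \<open>The value at \<open>h\<close> is 1 minus a squared modulus, which shows at once
    that it is real and at most 1.\<close>
  have le_one: "\<exists>t::real. \<omega> h = of_real t \<and> t \<le> 1"
    if h: "h \<in> carrier A" "h\<^sup>\<star> = h" "\<parallel>h\<parallel> \<le> 1/2" for h
  proof -
    obtain k where k: "k \<in> carrier A" "k\<^sup>\<star> = k" "k \<otimes> k = \<one> \<ominus> h"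
      using ex_selfadjoint_sqrt[OF h] by blast
    obtain y where y: "y \<in> carrier A" "E (k\<^sup>\<star> \<otimes> k) = y\<^sup>\<star> \<otimes> y" using positive[OF k(1)] by blast
    have "1 - \<omega> h = \<omega> (\<one> \<ominus> h)"
      using h by (simp add: diff_eq_scale \<omega>_add \<omega>_scale \<omega>_one)
    also have "\<dots> = \<psi> y z * cnj (\<psi> y z)"
      using k y by (simp add: \<omega>_def circle_hom_mult[OF \<psi>] circle_hom_star[OF \<psi>] star_closed)
    also have "\<dots> = of_real ((cmod (\<psi> y z))\<^sup>2)" by (simp only: complex_norm_square)
    finally have "\<omega> h = of_real (1 - (cmod (\<psi> y z))\<^sup>2)" by (simp add: algebra_simps)
    then show ?thesis by (intro exI[of _ "1 - (cmod (\<psi> y z))\<^sup>2"]) simp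
  qed
  have norm_le_one: "cmod (\<omega> h) \<le> 1"
    if h: "h \<in> carrier A" "h\<^sup>\<star> = h" "\<parallel>h\<parallel> \<le> 1/2" for h
  proof -
    obtain t where t: "\<omega> h = of_real t" "t \<le> 1" using le_one[OF h] by blast
    obtain t' where t': "\<omega> ((- 1) \<odot> h) = of_real t'" "t' \<le> 1"
      using le_one[of "(- 1) \<odot> h"] h by (auto simp: star_smult norm_scale)
    have "- t = t'"
      using t(1) t'(1) h(1) by (simp add: \<omega>_scale flip: of_real_minus)
    then show ?thesis using t t' by simp
  qed
  have sa: "cmod (\<omega> h) \<le> 2 * \<parallel>h\<parallel>" if h: "h \<in> carrier A" "h\<^sup>\<star> = h" for h
  proof (cases "h = \<zero>")
    case True
    then show ?thesis using \<omega>_scale[of \<zero> 0] norm_nonneg[of \<zero>] by simp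
  next
    case False
    then have pos: "0 < \<parallel>h\<parallel>" using norm_nonneg[OF h(1)] norm_eq_zero[OF h(1)] by simp
    \<comment> \<open>Rescales \<open>h\<close> to norm exactly 1/2, the largest norm at which the
      square root is available.\<close>
    define c :: complex where "c = of_real (1 / (2 * \<parallel>h\<parallel>))"
    have c: "cmod c = 1 / (2 * \<parallel>h\<parallel>)" "cnj c = c" using pos by (simp_all add: c_def norm_divide)
    have "cmod (\<omega> (c \<odot> h)) \<le> 1"
      using h pos c by (intro norm_le_one) (simp_all add: star_smult norm_scale)
    then have "cmod (\<omega> h) / (2 * \<parallel>h\<parallel>) \<le> 1"
      using h(1) c by (simp add: \<omega>_scale Real_Vector_Spaces.norm_mult)
    then show ?thesis using pos by (simp add: divide_le_eq)
  qed
  \<comment> \<open>Cartesian decomposition \<open>x = h + \<i> k\<close>; both parts have norm at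
    most that of \<open>x\<close>.\<close>
  define h where "h = (1/2) \<odot> (x \<oplus> x\<^sup>\<star>)"
  define k where "k = (- \<i>/2) \<odot> (x \<oplus> (- 1) \<odot> x\<^sup>\<star>)"
  have closed: "h \<in> carrier A" "k \<in> carrier A" using x by (simp_all add: h_def k_def star_closed)
  have sa_h: "h\<^sup>\<star> = h"
    using x by (simp add: h_def star_smult star_add star_closed star_star A.add.m_comm)
  have sa_k: "k\<^sup>\<star> = k"
    using x by (simp add: k_def star_smult star_add star_closed star_star A.add.m_comm
        scale_add_right scale_scale)
  have norm_h: "\<parallel>h\<parallel> \<le> \<parallel>x\<parallel>"
    using x norm_add[of x "x\<^sup>\<star>"] by (simp add: h_def star_closed norm_scale norm_divide)
  have norm_k: "\<parallel>k\<parallel> \<le> \<parallel>x\<parallel>"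
    using x norm_add[of x "(- 1) \<odot> x\<^sup>\<star>"]
    by (simp add: k_def star_closed norm_scale norm_divide)
  have "\<omega> x = \<omega> h + \<i> * \<omega> k"
    using x by (simp add: h_def k_def \<omega>_add \<omega>_scale star_closed field_simps)
  then have "cmod (\<omega> x) \<le> cmod (\<omega> h) + cmod (\<omega> k)"
    using norm_triangle_ineq[of "\<omega> h" "\<i> * \<omega> k"] by (simp add: Real_Vector_Spaces.norm_mult)
  then show ?thesis
    using sa[OF closed(1) sa_h] sa[OF closed(2) sa_k] norm_h norm_k by (simp add: \<omega>_def)
qed

text \<open>A quasi-basis expands every element of \<open>A\<close> over the range of \<open>E\<close> with finitely many fixed
  coefficients; if \<open>\<psi>\<close> is scalar on that range, the image of \<open>\<psi>\<close> is finite dimensional.\<close>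

lemma not_index_finite_type:
  assumes \<psi>: "star_hom A circle_algebra \<psi>"
    and scalar: "\<And>x z. \<lbrakk>x \<in> carrier A; z \<in> sphere 0 1\<rbrakk> \<Longrightarrow> \<psi> (E x) z = \<psi> (E x) 1"
    and a: "a \<in> carrier A" "\<psi> a = circle_gen"
  shows "\<not> index_finite_type A E"
proof
  assume "index_finite_type A E"
  then obtain n u v where uv: "quasi_basis A E n u v" by (auto simp: index_finite_type_def)
  have u: "u j \<in> carrier A" and v: "v j \<in> carrier A" if "j \<in> {1..n}" for j
    using uv that unfolding quasi_basis_def by auto
  show False
  proof (rule circle_powers_not_in_span)
    fix k :: nat and z :: complex assume z: "z \<in> sphere 0 1"
    define x where "x = a [^] k"
    have x: "x \<in> carrier A" using a by (simp add: x_def)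
    have "\<psi> x z = z ^ k"
      unfolding x_def using a z
      by (induction k) (simp_all add: circle_hom_one[OF \<psi>] circle_hom_mult[OF \<psi>] circle_gen_def circle_fun_def)
    moreover have "x = (\<Oplus>j\<in>{1..n}. u j \<otimes> E (v j \<otimes> x))"
      using uv x unfolding quasi_basis_def by blast
    then have "\<psi> x z = \<psi> (\<Oplus>j\<in>{1..n}. u j \<otimes> E (v j \<otimes> x)) z" by simp
    moreover have "\<psi> (\<Oplus>j\<in>{1..n}. u j \<otimes> E (v j \<otimes> x)) z = (\<Sum>j\<in>{1..n}. \<psi> (u j \<otimes> E (v j \<otimes> x)) z)"
      using u v x E_closed by (intro circle_hom_finsum[OF \<psi> unital_cstar_algebra_axioms]) auto
    \<comment> \<open>Evaluation at 1 picks out the constant value, giving coefficients that depend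
      on \<open>k\<close> and \<open>j\<close> but not on \<open>z\<close>.\<close>
    moreover have "\<psi> (u j \<otimes> E (v j \<otimes> x)) z = \<psi> (E (v j \<otimes> x)) 1 * \<psi> (u j) z" if "j \<in> {1..n}" for j
      using scalar[of "v j \<otimes> x" z] u[OF that] v[OF that] x z
      by (simp add: circle_hom_mult[OF \<psi>] E_closed)
    ultimately show "z ^ k = (\<Sum>j\<in>{1..n}. \<psi> (E (v j \<otimes> a [^] k)) 1 * \<psi> (u j) z)"
      by (simp add: x_def)
  qed simp
qed

end

section \<open>The coaction of the circle\<close>

locale circle_slice = min_tensor_product A A T tens
  for A :: "'a cstar" and T :: "'t cstar" and tens +
  fixes \<psi> :: "'a \<Rightarrow> complex \<Rightarrow> complex" and S :: "'t \<Rightarrow> 'a"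
  assumes psi_hom: "star_hom A circle_algebra \<psi>"
    and slice: "is_tensor_map A T tens A (smult A) (circle_haar \<circ> \<psi>) (\<lambda>x. x) S"
begin

lemma slice_bounded: "bounded_linear_map T A S"
  and slice_tens: "\<lbrakk>x \<in> carrier A; y \<in> carrier A\<rbrakk> \<Longrightarrow> S (tens x y) = circle_haar (\<psi> x) \<odot>\<^bsub>A\<^esub> y"
  using slice by (simp_all add: is_tensor_map_def)

lemma slice_closed: "s \<in> carrier T \<Longrightarrow> S s \<in> carrier A"
  and slice_add: "\<lbrakk>s \<in> carrier T; t \<in> carrier T\<rbrakk> \<Longrightarrow> S (s \<oplus>\<^bsub>T\<^esub> t) = S s \<oplus>\<^bsub>A\<^esub> S t"
  and slice_scale: "s \<in> carrier T \<Longrightarrow> S (c \<odot>\<^bsub>T\<^esub> s) = c \<odot>\<^bsub>A\<^esub> S s"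
  using slice_bounded unfolding bounded_linear_map_def by auto

text \<open>Additivity covers elementary sums and density covers the rest, so identities between
  bounded maps on \<open>T\<close> need checking on elementary tensors only.\<close>

lemma bounded_linear_map_eq_zero_tens:
  assumes F: "bounded_linear_map T A F"
    and zero: "\<And>x y. \<lbrakk>x \<in> carrier A; y \<in> carrier A\<rbrakk> \<Longrightarrow> F (tens x y) = \<zero>\<^bsub>A\<^esub>"
    and t: "t \<in> carrier T"
  shows "F t = \<zero>\<^bsub>A\<^esub>"
proof (rule bounded_linear_map_eq_zero[OF T.unital_cstar_algebra_axioms A.unital_cstar_algebra_axioms F])
  have F_add: "F (s \<oplus>\<^bsub>T\<^esub> t) = F s \<oplus>\<^bsub>A\<^esub> F t" if "s \<in> carrier T" "t \<in> carrier T" for s t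
    using F that unfolding bounded_linear_map_def by blast
  have "F (0 \<odot>\<^bsub>T\<^esub> \<zero>\<^bsub>T\<^esub>) = 0 \<odot>\<^bsub>A\<^esub> F \<zero>\<^bsub>T\<^esub>" "F \<zero>\<^bsub>T\<^esub> \<in> carrier A"
    using F T.zero_closed unfolding bounded_linear_map_def by blast+
  then have F_zero: "F \<zero>\<^bsub>T\<^esub> = \<zero>\<^bsub>A\<^esub>" by (metis T.scale_zero_right A.scale_zero_left)
  have *: "(\<Oplus>\<^bsub>T\<^esub>i\<in>{..<n}. tens (x i) (y i)) \<in> carrier T \<and> F (\<Oplus>\<^bsub>T\<^esub>i\<in>{..<n}. tens (x i) (y i)) = \<zero>\<^bsub>A\<^esub>"
    if "x \<in> {..<n} \<rightarrow> carrier A" "y \<in> {..<n} \<rightarrow> carrier A" for n :: nat and x y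
    using that
  proof (induction n)
    case 0
    then show ?case by (simp add: F_zero)
  next
    case (Suc n)
    have closed: "(\<lambda>i. tens (x i) (y i)) \<in> {..<n} \<rightarrow> carrier T" "tens (x n) (y n) \<in> carrier T"
      using Suc.prems by (auto intro!: tens_closed)
    have "(\<Oplus>\<^bsub>T\<^esub>i\<in>{..<Suc n}. tens (x i) (y i)) = tens (x n) (y n) \<oplus>\<^bsub>T\<^esub> (\<Oplus>\<^bsub>T\<^esub>i\<in>{..<n}. tens (x i) (y i))"
      unfolding lessThan_Suc using closed by (intro T.finsum_insert) auto
    then show ?case using closed Suc by (simp add: F_add zero Pi_iff)
  qed
  show "elementary_sums A A T tens \<subseteq> carrier T" using * by (auto simp: elementary_sums_def)
  show "F s = \<zero>\<^bsub>A\<^esub>" if "s \<in> elementary_sums A A T tens" for s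
    using that * by (auto simp: elementary_sums_def)
  show "t \<in> cstar_closure T (elementary_sums A A T tens)" using t tens_dense by simp
qed

text \<open>For elementary \<open>p\<close> and \<open>r\<close> the first leg becomes a product
  containing \<open>x\<close>, on which the multiplicative \<open>\<psi>\<close> vanishes. Density
  then frees \<open>p\<close> while \<open>r\<close> is still elementary, and afterwards
  \<open>r\<close>.\<close>

lemma slice_mult_tens_eq_zero:
  assumes x: "x \<in> carrier A" "\<And>z. \<psi> x z = 0" and y: "y \<in> carrier A"
    and p: "p \<in> carrier T" and r: "r \<in> carrier T"
  shows "S (p \<otimes>\<^bsub>T\<^esub> tens x y \<otimes>\<^bsub>T\<^esub> r) = \<zero>\<^bsub>A\<^esub>"
proof -
  have haar: "circle_haar (\<psi> (c \<otimes>\<^bsub>A\<^esub> x \<otimes>\<^bsub>A\<^esub> c')) = 0" if "c \<in> carrier A" "c' \<in> carrier A" for c c'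
    using x that by (simp add: circle_haar_def circle_hom_mult[OF psi_hom])
  have tens_r: "S (p \<otimes>\<^bsub>T\<^esub> tens x y \<otimes>\<^bsub>T\<^esub> tens c' d') = \<zero>\<^bsub>A\<^esub>"
    if c': "c' \<in> carrier A" "d' \<in> carrier A" for c' d'
  proof (rule bounded_linear_map_eq_zero_tens[OF _ _ p])
    show "bounded_linear_map T A (\<lambda>p. S (p \<otimes>\<^bsub>T\<^esub> tens x y \<otimes>\<^bsub>T\<^esub> tens c' d'))"
      using x y c' by (intro bounded_linear_map_comp[OF T.unital_cstar_algebra_axioms _ slice_bounded]
          bounded_linear_map_comp[OF T.unital_cstar_algebra_axioms _ T.bounded_linear_map_mult_right]
          T.bounded_linear_map_mult_right tens_closed)
    fix c d assume "c \<in> carrier A" "d \<in> carrier A"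
    then show "S (tens c d \<otimes>\<^bsub>T\<^esub> tens x y \<otimes>\<^bsub>T\<^esub> tens c' d') = \<zero>\<^bsub>A\<^esub>"
      using x y c' by (simp add: tens_mult slice_tens haar)
  qed
  show ?thesis
  proof (rule bounded_linear_map_eq_zero_tens[OF _ _ r])
    show "bounded_linear_map T A (\<lambda>r. S (p \<otimes>\<^bsub>T\<^esub> tens x y \<otimes>\<^bsub>T\<^esub> r))"
      using x y p by (intro bounded_linear_map_comp[OF T.unital_cstar_algebra_axioms _ slice_bounded]
          T.bounded_linear_map_mult_left T.m_closed tens_closed)
  qed (rule tens_r)
qed

text \<open>Since the slice map is only known to be linear, a two-sided ideal on which it vanishes
  stands in for the kernel of the tensor product of \<open>\<psi>\<close> and the identity.\<close>

definition slice_ideal :: "'t set" where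
  "slice_ideal = {s \<in> carrier T. \<forall>p\<in>carrier T. \<forall>r\<in>carrier T.
     S (p \<otimes>\<^bsub>T\<^esub> s \<otimes>\<^bsub>T\<^esub> r) = \<zero>\<^bsub>A\<^esub> \<and> S (p \<otimes>\<^bsub>T\<^esub> s\<^sup>\<star>\<^bsub>T\<^esub> \<otimes>\<^bsub>T\<^esub> r) = \<zero>\<^bsub>A\<^esub>}"

lemma slice_ideal_closed: "s \<in> slice_ideal \<Longrightarrow> s \<in> carrier T"
  by (simp add: slice_ideal_def)

lemma slice_ideal_eq_zero:
  assumes "s \<in> slice_ideal"
  shows "S s = \<zero>\<^bsub>A\<^esub>"
proof -
  have "S (\<one>\<^bsub>T\<^esub> \<otimes>\<^bsub>T\<^esub> s \<otimes>\<^bsub>T\<^esub> \<one>\<^bsub>T\<^esub>) = \<zero>\<^bsub>A\<^esub>"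
    using assms by (auto simp: slice_ideal_def simp del: T.l_one T.r_one)
  then show ?thesis using slice_ideal_closed[OF assms] by simp
qed

lemma slice_ideal_add:
  assumes s: "s \<in> slice_ideal" and t: "t \<in> slice_ideal"
  shows "s \<oplus>\<^bsub>T\<^esub> t \<in> slice_ideal"
  using s t unfolding slice_ideal_def
  by (auto simp: T.star_add T.r_distr T.l_distr slice_add T.star_closed)

lemma slice_ideal_scale:
  assumes s: "s \<in> slice_ideal"
  shows "c \<odot>\<^bsub>T\<^esub> s \<in> slice_ideal"
  using s unfolding slice_ideal_def
  by (auto simp: T.star_smult T.smult_mult_right T.smult_mult_left slice_scale T.star_closed)

text \<open>Closure under star is built into the definition, because \<open>S\<close> is not known
  to commute with stars.\<close>

lemma slice_ideal_star:
  assumes s: "s \<in> slice_ideal"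
  shows "s\<^sup>\<star>\<^bsub>T\<^esub> \<in> slice_ideal"
  using s unfolding slice_ideal_def by (auto simp: T.star_star T.star_closed)

text \<open>The factor \<open>t\<close> is absorbed by \<open>p\<close>; in the starred condition
  its star lands on the other side and is absorbed by \<open>r\<close>. The right-handed version
  follows by taking stars.\<close>

lemma slice_ideal_mult_left:
  assumes s: "s \<in> slice_ideal" and t: "t \<in> carrier T"
  shows "t \<otimes>\<^bsub>T\<^esub> s \<in> slice_ideal"
proof -
  have sT: "s \<in> carrier T" using s by (rule slice_ideal_closed)
  have "S (p \<otimes>\<^bsub>T\<^esub> (t \<otimes>\<^bsub>T\<^esub> s) \<otimes>\<^bsub>T\<^esub> r) = \<zero>\<^bsub>A\<^esub>
      \<and> S (p \<otimes>\<^bsub>T\<^esub> (t \<otimes>\<^bsub>T\<^esub> s)\<^sup>\<star>\<^bsub>T\<^esub> \<otimes>\<^bsub>T\<^esub> r) = \<zero>\<^bsub>A\<^esub>"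
    if p: "p \<in> carrier T" and r: "r \<in> carrier T" for p r
  proof -
    have "p \<otimes>\<^bsub>T\<^esub> (t \<otimes>\<^bsub>T\<^esub> s) \<otimes>\<^bsub>T\<^esub> r = (p \<otimes>\<^bsub>T\<^esub> t) \<otimes>\<^bsub>T\<^esub> s \<otimes>\<^bsub>T\<^esub> r"
      "p \<otimes>\<^bsub>T\<^esub> (t \<otimes>\<^bsub>T\<^esub> s)\<^sup>\<star>\<^bsub>T\<^esub> \<otimes>\<^bsub>T\<^esub> r = p \<otimes>\<^bsub>T\<^esub> s\<^sup>\<star>\<^bsub>T\<^esub> \<otimes>\<^bsub>T\<^esub> (t\<^sup>\<star>\<^bsub>T\<^esub> \<otimes>\<^bsub>T\<^esub> r)"
      using p r t sT by (simp_all add: T.star_mult T.m_assoc T.star_closed)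
    then show ?thesis using s p r t T.star_closed[OF t] by (simp add: slice_ideal_def)
  qed
  then show ?thesis using t sT by (simp add: slice_ideal_def)
qed

lemma slice_ideal_mult_right:
  assumes s: "s \<in> slice_ideal" and t: "t \<in> carrier T"
  shows "s \<otimes>\<^bsub>T\<^esub> t \<in> slice_ideal"
proof -
  have sT: "s \<in> carrier T" using s by (rule slice_ideal_closed)
  have "(t\<^sup>\<star>\<^bsub>T\<^esub> \<otimes>\<^bsub>T\<^esub> s\<^sup>\<star>\<^bsub>T\<^esub>)\<^sup>\<star>\<^bsub>T\<^esub> \<in> slice_ideal"
    by (intro slice_ideal_star slice_ideal_mult_left s T.star_closed t)
  then show ?thesis using sT t by (simp add: T.star_mult T.star_star T.star_closed)
qed

lemma slice_ideal_tens:
  assumes x: "x \<in> carrier A" "\<And>z. \<psi> x z = 0" and y: "y \<in> carrier A"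
  shows "tens x y \<in> slice_ideal"
proof -
  have "\<psi> (x\<^sup>\<star>\<^bsub>A\<^esub>) z = 0" for z using x by (simp add: circle_hom_star[OF psi_hom])
  then show ?thesis
    unfolding slice_ideal_def using x y
    by (auto simp: tens_star tens_closed A.star_closed intro!: slice_mult_tens_eq_zero)
qed

end

section \<open>The grading by degree for the circle action\<close>

locale circle_coaction = circle_slice A T tens \<psi> S
  for A :: "'a cstar" and T :: "'t cstar" and tens \<psi> S +
  fixes \<Delta> :: "'a \<Rightarrow> 't"
  assumes comult_hom: "star_hom A T \<Delta>"
begin

lemma comult_closed: "x \<in> carrier A \<Longrightarrow> \<Delta> x \<in> carrier T"
  and comult_add: "\<lbrakk>x \<in> carrier A; y \<in> carrier A\<rbrakk> \<Longrightarrow> \<Delta> (x \<oplus>\<^bsub>A\<^esub> y) = \<Delta> x \<oplus>\<^bsub>T\<^esub> \<Delta> y"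
  and comult_mult: "\<lbrakk>x \<in> carrier A; y \<in> carrier A\<rbrakk> \<Longrightarrow> \<Delta> (x \<otimes>\<^bsub>A\<^esub> y) = \<Delta> x \<otimes>\<^bsub>T\<^esub> \<Delta> y"
  and comult_scale: "x \<in> carrier A \<Longrightarrow> \<Delta> (c \<odot>\<^bsub>A\<^esub> x) = c \<odot>\<^bsub>T\<^esub> \<Delta> x"
  and comult_star: "x \<in> carrier A \<Longrightarrow> \<Delta> (x\<^sup>\<star>\<^bsub>A\<^esub>) = (\<Delta> x)\<^sup>\<star>\<^bsub>T\<^esub>"
  and comult_one: "\<Delta> \<one>\<^bsub>A\<^esub> = \<one>\<^bsub>T\<^esub>"
  using comult_hom unfolding star_hom_def ring_hom_def by auto

text \<open>\<open>homogeneous c m x\<close> says that \<open>x\<close> has degree \<open>m\<close> for the circle action: modulo the slice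
  ideal, the comultiplication sends \<open>x\<close> to \<open>c \<otimes> x\<close>, where \<open>c\<close> represents the character \<open>z \<mapsto> z\<^sup>m\<close>.\<close>

definition homogeneous :: "'a \<Rightarrow> int \<Rightarrow> 'a \<Rightarrow> bool" where
  "homogeneous c m x \<longleftrightarrow>
     c \<in> carrier A \<and> x \<in> carrier A \<and>
     (\<forall>z\<in>sphere 0 1. \<psi> c z = z powi m) \<and>
     (\<exists>l. \<forall>z\<in>sphere 0 1. \<psi> x z = l * z powi m) \<and>
     \<Delta> x \<ominus>\<^bsub>T\<^esub> tens c x \<in> slice_ideal"

lemma homogeneous_one: "homogeneous \<one>\<^bsub>A\<^esub> 0 \<one>\<^bsub>A\<^esub>"
proof -
  \<comment> \<open>The difference is zero; writing it as a tensor with first leg zero puts it in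
    the scope of \<open>slice_ideal_tens\<close>.\<close>
  have "\<Delta> \<one>\<^bsub>A\<^esub> \<ominus>\<^bsub>T\<^esub> tens \<one>\<^bsub>A\<^esub> \<one>\<^bsub>A\<^esub> = tens \<zero>\<^bsub>A\<^esub> \<one>\<^bsub>A\<^esub>"
    using tens_smult_left[of "\<zero>\<^bsub>A\<^esub>" "\<one>\<^bsub>A\<^esub>" 0] tens_closed[of "\<zero>\<^bsub>A\<^esub>" "\<one>\<^bsub>A\<^esub>"]
    by (simp add: comult_one tens_one T.diff_eq_zero)
  moreover have "\<psi> \<zero>\<^bsub>A\<^esub> z = 0" for z using circle_hom_scale[OF psi_hom, of "\<zero>\<^bsub>A\<^esub>" 0 z] by simp
  ultimately show ?thesis
    by (auto simp: homogeneous_def circle_hom_one[OF psi_hom] circle_fun_def slice_ideal_tens)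
qed

lemma homogeneous_scale:
  assumes x: "homogeneous c m x"
  shows "homogeneous c m (k \<odot>\<^bsub>A\<^esub> x)"
proof -
  have closed: "c \<in> carrier A" "x \<in> carrier A" "tens c x \<in> carrier T" "\<Delta> x \<in> carrier T"
    using x by (simp_all add: homogeneous_def tens_closed comult_closed)
  obtain l where l: "\<forall>z\<in>sphere 0 1. \<psi> x z = l * z powi m" using x by (auto simp: homogeneous_def)
  have "\<Delta> (k \<odot>\<^bsub>A\<^esub> x) \<ominus>\<^bsub>T\<^esub> tens c (k \<odot>\<^bsub>A\<^esub> x) = k \<odot>\<^bsub>T\<^esub> (\<Delta> x \<ominus>\<^bsub>T\<^esub> tens c x)"
    using closed by (simp add: comult_scale tens_smult_right T.scale_diff)
  moreover have "\<dots> \<in> slice_ideal" using x by (simp add: homogeneous_def slice_ideal_scale)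
  ultimately show ?thesis
    using x closed l unfolding homogeneous_def
    by (auto simp: circle_hom_scale[OF psi_hom] intro!: exI[of _ "k * l"])
qed

text \<open>Telescoping: \<open>X Y - x y = (X - x) Y + x (Y - y)\<close>, where two-sidedness of
  the ideal handles both terms.\<close>

lemma homogeneous_mult:
  assumes x: "homogeneous c m x" and y: "homogeneous d n y"
  shows "homogeneous (c \<otimes>\<^bsub>A\<^esub> d) (m + n) (x \<otimes>\<^bsub>A\<^esub> y)"
proof -
  have closed: "c \<in> carrier A" "x \<in> carrier A" "tens c x \<in> carrier T" "\<Delta> x \<in> carrier T"
    "d \<in> carrier A" "y \<in> carrier A" "tens d y \<in> carrier T" "\<Delta> y \<in> carrier T"
    using x y by (simp_all add: homogeneous_def tens_closed comult_closed)
  obtain l k where l: "\<forall>z\<in>sphere 0 1. \<psi> x z = l * z powi m"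
    and k: "\<forall>z\<in>sphere 0 1. \<psi> y z = k * z powi n" using x y by (auto simp: homogeneous_def)
  have powi: "z powi (m + n) = z powi m * z powi n" if "z \<in> sphere 0 1" for z :: complex
    using that by (intro power_int_add) auto
  have "\<Delta> (x \<otimes>\<^bsub>A\<^esub> y) \<ominus>\<^bsub>T\<^esub> tens (c \<otimes>\<^bsub>A\<^esub> d) (x \<otimes>\<^bsub>A\<^esub> y)
      = \<Delta> x \<otimes>\<^bsub>T\<^esub> \<Delta> y \<ominus>\<^bsub>T\<^esub> tens c x \<otimes>\<^bsub>T\<^esub> tens d y"
    using closed by (simp add: comult_mult tens_mult)
  also have "\<dots> = (\<Delta> x \<ominus>\<^bsub>T\<^esub> tens c x) \<otimes>\<^bsub>T\<^esub> \<Delta> y \<oplus>\<^bsub>T\<^esub> tens c x \<otimes>\<^bsub>T\<^esub> (\<Delta> y \<ominus>\<^bsub>T\<^esub> tens d y)"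
    using closed(3,4,7,8) by algebra
  also have "\<dots> \<in> slice_ideal"
    using x y closed unfolding homogeneous_def
    by (intro slice_ideal_add slice_ideal_mult_left slice_ideal_mult_right) auto
  finally have "\<Delta> (x \<otimes>\<^bsub>A\<^esub> y) \<ominus>\<^bsub>T\<^esub> tens (c \<otimes>\<^bsub>A\<^esub> d) (x \<otimes>\<^bsub>A\<^esub> y) \<in> slice_ideal" .
  moreover have "\<forall>z\<in>sphere 0 1. \<psi> (x \<otimes>\<^bsub>A\<^esub> y) z = (l * k) * z powi (m + n)"
    using closed l k by (simp add: circle_hom_mult[OF psi_hom] powi)
  moreover have "\<forall>z\<in>sphere 0 1. \<psi> (c \<otimes>\<^bsub>A\<^esub> d) z = z powi (m + n)"
    using x y by (simp add: homogeneous_def circle_hom_mult[OF psi_hom] powi)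
  ultimately show ?thesis
    using closed unfolding homogeneous_def by blast
qed

lemma homogeneous_star:
  assumes x: "homogeneous c m x"
  shows "homogeneous (c\<^sup>\<star>\<^bsub>A\<^esub>) (- m) (x\<^sup>\<star>\<^bsub>A\<^esub>)"
proof -
  have closed: "c \<in> carrier A" "x \<in> carrier A" "tens c x \<in> carrier T" "\<Delta> x \<in> carrier T"
    using x by (simp_all add: homogeneous_def tens_closed comult_closed)
  obtain l where l: "\<forall>z\<in>sphere 0 1. \<psi> x z = l * z powi m" using x by (auto simp: homogeneous_def)
  \<comment> \<open>On the unit circle conjugation is inversion, which is why the star negates the
    degree.\<close>
  have cnj_powi: "cnj z powi m = z powi (- m)" if z: "cmod z = 1" for z
  proof -
    have "cnj z = inverse z"
      using z complex_norm_square[of z] by (intro inverse_unique[symmetric]) simp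
    then show ?thesis by (simp add: power_int_minus power_int_inverse)
  qed
  have "\<Delta> (x\<^sup>\<star>\<^bsub>A\<^esub>) \<ominus>\<^bsub>T\<^esub> tens (c\<^sup>\<star>\<^bsub>A\<^esub>) (x\<^sup>\<star>\<^bsub>A\<^esub>) = (\<Delta> x \<ominus>\<^bsub>T\<^esub> tens c x)\<^sup>\<star>\<^bsub>T\<^esub>"
    using closed by (simp add: comult_star tens_star T.star_diff)
  moreover have "\<dots> \<in> slice_ideal" using x by (simp add: homogeneous_def slice_ideal_star)
  ultimately show ?thesis
    using x closed l unfolding homogeneous_def
    by (auto simp: circle_hom_star[OF psi_hom] A.star_closed cnj_powi intro!: exI[of _ "cnj l"])
qed

text \<open>Sums suffice to generate a linear span, since multiples of homogeneous elements are
  homogeneous; degrees may differ between summands.\<close>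

inductive_set homogeneous_span :: "'a set" where
  base: "homogeneous c m x \<Longrightarrow> x \<in> homogeneous_span"
| add: "\<lbrakk>x \<in> homogeneous_span; y \<in> homogeneous_span\<rbrakk> \<Longrightarrow> x \<oplus>\<^bsub>A\<^esub> y \<in> homogeneous_span"

lemma homogeneous_span_closed: "x \<in> homogeneous_span \<Longrightarrow> x \<in> carrier A"
  by (induction rule: homogeneous_span.induct) (auto simp: homogeneous_def)

lemma homogeneous_span_star_subalgebra: "unital_star_subalgebra A homogeneous_span"
proof -
  have scale: "k \<odot>\<^bsub>A\<^esub> x \<in> homogeneous_span" if "x \<in> homogeneous_span" for k x
    using that
    by (induction rule: homogeneous_span.induct)
      (auto simp: A.scale_add_right homogeneous_span_closed
        intro: homogeneous_span.intros homogeneous_scale)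
  have star: "x\<^sup>\<star>\<^bsub>A\<^esub> \<in> homogeneous_span" if "x \<in> homogeneous_span" for x
    using that
    by (induction rule: homogeneous_span.induct)
      (auto simp: A.star_add homogeneous_span_closed
        intro: homogeneous_span.intros homogeneous_star)
  \<comment> \<open>Products are treated one factor at a time: the left factor is homogeneous here
    and general in the next induction.\<close>
  have mult_hom: "x \<otimes>\<^bsub>A\<^esub> y \<in> homogeneous_span" if x: "homogeneous c m x" and "y \<in> homogeneous_span" for c m x y
    using that(2)
  proof (induction rule: homogeneous_span.induct)
    case (base d n y)
    then show ?case using homogeneous_mult[OF x] homogeneous_span.base by blast
  next
    case (add y y')
    moreover have "x \<in> carrier A" using x by (simp add: homogeneous_def)
    ultimately show ?case
      by (simp add: A.A.r_distr homogeneous_span_closed homogeneous_span.add)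
  qed
  have mult: "x \<otimes>\<^bsub>A\<^esub> y \<in> homogeneous_span" if "x \<in> homogeneous_span" and y: "y \<in> homogeneous_span" for x y
    using that(1)
  proof (induction rule: homogeneous_span.induct)
    case (base c m x)
    then show ?case using mult_hom y by blast
  next
    case (add x x')
    then show ?case
      using y by (simp add: A.A.l_distr homogeneous_span_closed homogeneous_span.add)
  qed
  show ?thesis
    unfolding unital_star_subalgebra_def
    by (intro conjI ballI allI subsetI)
      (simp_all only: homogeneous_span_closed scale star mult homogeneous_span.base[OF homogeneous_one]
        homogeneous_span.add)
qed

text \<open>Slicing gives \<open>circle_haar (\<psi> c)\<close> times \<open>x\<close>. For nonzero
  degree the integral vanishes; for degree 0 the function \<open>\<psi> x\<close> is already
  constant on the circle.\<close>

lemma circle_hom_slice_comult_homogeneous: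
  assumes x: "homogeneous c m x" and z: "z \<in> sphere 0 1"
  shows "\<psi> (S (\<Delta> x)) z = \<psi> (S (\<Delta> x)) 1"
proof -
  have closed: "c \<in> carrier A" "x \<in> carrier A" "tens c x \<in> carrier T" "\<Delta> x \<in> carrier T"
    using x by (simp_all add: homogeneous_def tens_closed comult_closed)
  obtain l where l: "\<forall>z\<in>sphere 0 1. \<psi> x z = l * z powi m" using x by (auto simp: homogeneous_def)
  have "\<Delta> x = (\<Delta> x \<ominus>\<^bsub>T\<^esub> tens c x) \<oplus>\<^bsub>T\<^esub> tens c x" using closed(3,4) by algebra
  then have "S (\<Delta> x) = S (\<Delta> x \<ominus>\<^bsub>T\<^esub> tens c x) \<oplus>\<^bsub>A\<^esub> S (tens c x)"
    using slice_add[of "\<Delta> x \<ominus>\<^bsub>T\<^esub> tens c x" "tens c x"] closed by simp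
  also have "\<dots> = circle_haar (\<psi> c) \<odot>\<^bsub>A\<^esub> x"
    using x closed by (simp add: homogeneous_def slice_ideal_eq_zero slice_tens)
  finally have "S (\<Delta> x) = circle_haar (\<psi> c) \<odot>\<^bsub>A\<^esub> x" .
  then have eq: "\<psi> (S (\<Delta> x)) w = circle_haar (\<psi> c) * \<psi> x w" for w
    using closed by (simp add: circle_hom_scale[OF psi_hom])
  show ?thesis
  proof (cases "m = 0")
    case True
    then show ?thesis using l z by (simp add: eq)
  next
    case False
    then have "circle_haar (\<psi> c) = 0"
      using x by (intro circle_haar_power_int[of _ m]) (simp_all add: homogeneous_def)
    then show ?thesis by (simp add: eq)
  qed
qed

lemma circle_hom_slice_comult_span:
  assumes "x \<in> homogeneous_span" and z: "z \<in> sphere 0 1"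
  shows "\<psi> (S (\<Delta> x)) z = \<psi> (S (\<Delta> x)) 1"
  using assms(1)
proof (induction rule: homogeneous_span.induct)
  case (base c m x)
  then show ?case using circle_hom_slice_comult_homogeneous z by blast
next
  case (add x y)
  then show ?case
    by (simp add: comult_add homogeneous_span_closed comult_closed slice_add slice_closed
        circle_hom_add[OF psi_hom])
qed

end

theorem proposition4p5:
  fixes q :: complex and \<theta> :: real
    and A :: "'a cstar" and a b D :: 'a
    and T :: "'t cstar" and tens :: "'a \<Rightarrow> 'a \<Rightarrow> 't"
    and P :: "'p cstar" and tensP :: "(complex \<Rightarrow> complex) \<Rightarrow> 'a \<Rightarrow> 'p"
    and \<Delta> :: "'a \<Rightarrow> 't" and \<psi> :: "'a \<Rightarrow> complex \<Rightarrow> complex"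
    and \<psi>_id :: "'t \<Rightarrow> 'p" and h\<psi>_id :: "'t \<Rightarrow> 'a"
    and E\<psi> :: "'a \<Rightarrow> 'a"
  assumes "q \<noteq> 0" and "cmod q \<noteq> 1"
    and "\<theta> = Arg q / pi" and "\<theta> \<notin> \<rat>"
    and "is_C_Uq2 q A a b D"
    and "min_tensor_product A A T tens"
    and "min_tensor_product circle_algebra A P tensP"
    and "is_Uq2_comult q A a b D T tens \<Delta>"
    and "is_circle_quotient_map A a b D \<psi>"
    and "is_tensor_map A T tens P tensP \<psi> (\<lambda>x. x) \<psi>_id"
    and "is_tensor_map A T tens A (smult A) (circle_haar \<circ> \<psi>) (\<lambda>x. x) h\<psi>_id"
    and "\<forall>x\<in>carrier A. E\<psi> x = h\<psi>_id (\<Delta> x)"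
    and "conditional_expectation A (circle_quotient A tensP \<Delta> \<psi>_id) E\<psi>"
  shows "\<not> index_finite_type A E\<psi>"
proof -
  interpret U: Uq2_relations A q a b D using assms(5) by (simp add: is_C_Uq2_def)
  interpret C: circle_coaction A T tens \<psi> h\<psi>_id \<Delta>
    using assms(6,8,9,11)
    by (simp add: circle_coaction_def circle_coaction_axioms_def circle_slice_def
        circle_slice_axioms_def is_Uq2_comult_def is_circle_quotient_map_def)
  interpret E: conditional_expectation A "circle_quotient A tensP \<Delta> \<psi>_id" E\<psi>
    by (rule assms(13))
  note \<psi> = C.psi_hom
  note gens = U.gens_closed
  have \<psi>_gens: "\<psi> a = circle_gen" "\<psi> b z = 0" "\<psi> D = circle_fun (\<lambda>_. 1)" for z
    using assms(9) by (simp_all add: is_circle_quotient_map_def)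
  have \<Delta>_gens:
    "\<Delta> a = tens a a \<ominus>\<^bsub>T\<^esub> cnj q \<odot>\<^bsub>T\<^esub> tens b (D \<otimes>\<^bsub>A\<^esub> b\<^sup>\<star>\<^bsub>A\<^esub>)"
    "\<Delta> b = tens a b \<oplus>\<^bsub>T\<^esub> tens b (D \<otimes>\<^bsub>A\<^esub> a\<^sup>\<star>\<^bsub>A\<^esub>)" "\<Delta> D = tens D D"
    using assms(8) by (simp_all add: is_Uq2_comult_def)
  \<comment> \<open>Since \<open>\<psi> b = 0\<close>, this discards the second summands of
    \<open>\<Delta> a\<close> and \<open>\<Delta> b\<close>.\<close>
  have ideal: "tens b x \<in> C.slice_ideal" if "x \<in> carrier A" for x
    using that gens \<psi>_gens by (intro C.slice_ideal_tens) auto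
  \<comment> \<open>These are the three shapes of \<open>\<Delta> x\<close> minus its leading
    tensor, for \<open>a\<close>, \<open>b\<close> and \<open>D\<close>. The zero difference for
    \<open>D\<close> is written as a multiple of an auxiliary \<open>u\<close>, so that closure of
    the ideal under scaling applies.\<close>
  have diff: "t \<ominus>\<^bsub>T\<^esub> c \<odot>\<^bsub>T\<^esub> u \<ominus>\<^bsub>T\<^esub> t = (- c) \<odot>\<^bsub>T\<^esub> u" "t \<oplus>\<^bsub>T\<^esub> u \<ominus>\<^bsub>T\<^esub> t = u" "t \<ominus>\<^bsub>T\<^esub> t = 0 \<odot>\<^bsub>T\<^esub> u"
    if tu: "t \<in> carrier T" "u \<in> carrier T" for t u c
  proof -
    have cu: "c \<odot>\<^bsub>T\<^esub> u \<in> carrier T" using tu by simp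
    have "t \<ominus>\<^bsub>T\<^esub> c \<odot>\<^bsub>T\<^esub> u \<ominus>\<^bsub>T\<^esub> t = \<ominus>\<^bsub>T\<^esub> (c \<odot>\<^bsub>T\<^esub> u)" using tu(1) cu by algebra
    then show "t \<ominus>\<^bsub>T\<^esub> c \<odot>\<^bsub>T\<^esub> u \<ominus>\<^bsub>T\<^esub> t = (- c) \<odot>\<^bsub>T\<^esub> u"
      using tu by (simp add: C.T.minus_eq_scale C.T.scale_scale)
    show "t \<oplus>\<^bsub>T\<^esub> u \<ominus>\<^bsub>T\<^esub> t = u" using tu by algebra
    show "t \<ominus>\<^bsub>T\<^esub> t = 0 \<odot>\<^bsub>T\<^esub> u" using tu by (simp add: C.T.diff_eq_zero)
  qed
  have "C.homogeneous a 1 a"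
    unfolding C.homogeneous_def \<Delta>_gens \<psi>_gens
    using gens U.star_closed[OF gens(2)]
    by (auto simp: diff C.tens_closed circle_gen_def circle_fun_def
        intro!: C.slice_ideal_scale ideal exI[of _ 1])
  \<comment> \<open>The degree 1 character is represented by \<open>a\<close>, not by
    \<open>b\<close>; the multiple \<open>l\<close> is 0 here because
    \<open>\<psi> b = 0\<close>.\<close>
  moreover have "C.homogeneous a 1 b"
    unfolding C.homogeneous_def \<Delta>_gens \<psi>_gens
    using gens U.star_closed[OF gens(1)]
    by (auto simp: diff C.tens_closed circle_gen_def circle_fun_def
        intro!: ideal exI[of _ 0])
  moreover have "C.homogeneous D 0 D"
    unfolding C.homogeneous_def \<Delta>_gens \<psi>_gens
    using gens C.slice_ideal_scale[OF ideal[OF gens(3)], of 0] C.tens_closed[of b D]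
    by (auto simp: diff(3)[of _ "tens b D"] C.tens_closed circle_fun_def intro!: exI[of _ 1])
  ultimately have "{a, b, D} \<subseteq> C.homogeneous_span"
    by (auto intro: C.homogeneous_span.base)
  then have dense: "x \<in> cstar_closure A C.homogeneous_span" if "x \<in> carrier A" for x
    using U.cstar_generated_subset_closure[OF C.homogeneous_span_star_subalgebra] assms(5) that
    unfolding is_C_Uq2_def by blast
  show ?thesis
  proof (rule E.not_index_finite_type[OF \<psi> _ gens(1) \<psi>_gens(1)])
    fix x and z :: complex assume x: "x \<in> carrier A" and z: "z \<in> sphere 0 1"
    \<comment> \<open>The approximant \<open>y\<close> contributes equally at \<open>z\<close> and 1
      and cancels. The remainder \<open>d\<close> is bounded by \<open>4 * cnorm A d\<close> at each
      of the two points, hence the tolerance \<open>e / 8\<close>.\<close>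
    have "cmod (\<psi> (E\<psi> x) z - \<psi> (E\<psi> x) 1) \<le> 0 + e" if e: "0 < e" for e
    proof -
      obtain y where y: "y \<in> C.homogeneous_span" "cnorm A (x \<ominus>\<^bsub>A\<^esub> y) < e / 8"
        using dense[OF x] e unfolding cstar_closure_def by (auto dest: spec[of _ "e / 8"])
      have y_carrier: "y \<in> carrier A" using y(1) by (rule C.homogeneous_span_closed)
      define d where "d = x \<ominus>\<^bsub>A\<^esub> y"
      have d: "d \<in> carrier A" using x y_carrier by (simp add: d_def)
      have "x = d \<oplus>\<^bsub>A\<^esub> y" unfolding d_def using x y_carrier by algebra
      then have eq: "\<psi> (E\<psi> x) w = \<psi> (E\<psi> d) w + \<psi> (E\<psi> y) w" for w
        using d y_carrier by (simp add: E.add E.E_closed circle_hom_add[OF \<psi>])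
      have "\<psi> (E\<psi> y) z = \<psi> (E\<psi> y) 1"
        using C.circle_hom_slice_comult_span[OF y(1) z] assms(12) y_carrier by simp
      then have "cmod (\<psi> (E\<psi> x) z - \<psi> (E\<psi> x) 1) = cmod (\<psi> (E\<psi> d) z - \<psi> (E\<psi> d) 1)"
        by (simp add: eq)
      also have "\<dots> \<le> 4 * cnorm A d + 4 * cnorm A d"
        using E.norm_circle_hom_E_le[OF \<psi> d z] E.norm_circle_hom_E_le[OF \<psi> d, of 1]
          norm_triangle_ineq4[of "\<psi> (E\<psi> d) z" "\<psi> (E\<psi> d) 1"] by simp
      finally show ?thesis using y(2) by (simp add: d_def)
    qed
    then have "cmod (\<psi> (E\<psi> x) z - \<psi> (E\<psi> x) 1) \<le> 0" by (rule field_le_epsilon)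
    then show "\<psi> (E\<psi> x) z = \<psi> (E\<psi> x) 1" by simp
  qed
qed

end
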